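(* Let $\mathbb{K}\in\{\mathbb{R},\mathbb{C}\}$, let $A,E\in\mathbb{K}^{n\times n}$, put $\widetilde{A}=A+E$, and let $A$ have rank $k\ge1$ and compact SVD $A=W_k\Sigma_kV_k^*$. Let $I,J\subset\{1,\dots,n\}$ with $|I|=|J|$, and put $C=A(:,J)$, $R=A(I,:)$, $U=A(I,J)$, $\widetilde{C}=\widetilde{A}(:,J)$, $\widetilde{R}=\widetilde{A}(I,:)$, $\widetilde{U}=\widetilde{A}(I,J)$. Assume $\operatorname{rank}(C)=\operatorname{rank}(U)=\operatorname{rank}(R)=k$. Let $\|\cdot\|$ be a normalized, uniformly generated, unitarily invariant, submultiplicative norm with pseudoinverse perturbation constant $\mu\in[1,3]$ (see context). Suppose that $W_{k,I}=W_k(I,:)$ has maximal volume among all $|I|\times k$ submatrices of $W_k$ and $V_{k,J}=V_k(J,:)$ has maximal volume among all $|J|\times k$ submatrices of $V_k$. Put \[ t=\sqrt{1+\frac{k(n-|I|)}{|I|-k+1}}. \] Then \[\|A-\widetilde{C}_k\widetilde{C}_k^\dagger\widetilde{A}\widetilde{R}_k^\dagger\widetilde{R}_k\|\leq (4t+3)\|E\|.\] If additionally $\sigma_k(A)\geq 4\mu t^2\|E\|$, then \[ \|A-\widetilde{C}\widetilde{U}_k^\dagger\widetilde{R}\|\leq \left(\frac{1}{2\mu}+\left(2+\frac{1}{\mu}\right)t+\left(4+\frac{1}{2\mu}\right)t^2\right)\|E\|.\]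
   Context: For a matrix $B$ and index sets $I,J$, $B(I,J)$ is the submatrix with rows in $I$ and columns in $J$; $B(I,:)$ keeps all columns and $B(:,J)$ keeps all rows. $B^\dagger$ is the Moore--Penrose pseudoinverse; $\|B\|_2$ is the spectral norm; $\sigma_i(B)$ is the $i$-th singular value in descending order. $B_k$ denotes the truncated SVD of order $k$ of $B$ (best rank-$k$ approximation), and $B_k^\dagger=(B_k)^\dagger$. The volume of $B\in\mathbb{K}^{p\times q}$ is $\prod_{i=1}^{\min\{p,q\}}\sigma_i(B)$. The compact SVD of a rank-$k$ matrix $A\in\mathbb{K}^{m\times n}$ is $A=W_k\Sigma_kV_k^*$ with $W_k\in\mathbb{K}^{m\times k}$, $V_k\in\mathbb{K}^{n\times k}$ having orthonormal columns and $\Sigma_k$ the $k\times k$ diagonal matrix of the positive singular values in descending order. A "normalized, uniformly generated, unitarily invariant, submultiplicative norm" is a family of norms $\|\cdot\|:\bigcup_{p,q\ge 1}\mathbb{K}^{p\times q}\to\mathbb{R}$ (a norm on each $\mathbb{K}^{p\times q}$) such that: $\|x\|=\|x\|_2$ (Euclidean norm) for every vector $x$ viewed as a matrix (normalized); there is a single symmetric function $\phi$ with $\|B\|=\phi(\sigma_1(B),\dots,\sigma_r(B))$, $r=\operatorname{rank}(B)$, for matrices $B$ of every size (uniformly generated); $\|\cdot\|$ is invariant under left and right multiplication by unitary matrices; and $\|BD\|\le\|B\|\|D\|$ whenever $BD$ is defined. All Schatten $p$-norms, $1\le p\le\infty$, are examples. Pseudoinverse perturbation constant (Stewart): $\mu\in[1,3]$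 is a constant depending only on the norm $\|\cdot\|$ such that for all matrices $B,\widetilde{B}$ of the same size, $\|B^\dagger-\widetilde{B}^\dagger\|\le\mu\|\widetilde{B}^\dagger\|_2\|B^\dagger\|_2\|\widetilde{B}-B\|$ if $\operatorname{rank}(B)=\operatorname{rank}(\widetilde{B})$, and $\|B^\dagger-\widetilde{B}^\dagger\|\le\mu\max\{\|\widetilde{B}^\dagger\|_2^2,\|B^\dagger\|_2^2\}\|\widetilde{B}-B\|$ otherwise. ($\mu=3$ works for every such norm; $\mu=\sqrt2$ for the Frobenius norm, $\mu=\frac{1+\sqrt5}{2}$ for the spectral norm.) *)

theory Defs
  imports
    Complex_Main
    "HOL-Library.Multiset"
    "HOL-Computational_Algebra.Polynomial"
    "Jordan_Normal_Form.Char_Poly"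
    "Jordan_Normal_Form.Schur_Decomposition"
    "Jordan_Normal_Form.DL_Rank"
    "Jordan_Normal_Form.DL_Submatrix"
begin

text \<open>
  The scalar field is a set \<^term>\<open>K :: complex set\<close>, either \<^term>\<open>\<real> :: complex set\<close> or
  \<^term>\<open>UNIV :: complex set\<close>; a real matrix is a complex matrix with real entries. Quantification
  over matrices (in norms, unitary factors, singular value decompositions) is always restricted to
  matrices with entries in \<^term>\<open>K\<close>. Matrix indices start at 0.
\<close>

definition mats :: "complex set \<Rightarrow> nat \<Rightarrow> nat \<Rightarrow> complex mat set" where
  "mats K p q = {B \<in> carrier_mat p q. elements_mat B \<subseteq> K}"

definition mrank :: "complex mat \<Rightarrow> nat" where
  "mrank B = vec_space.rank (dim_row B) B"

definition unitary_mats :: "complex set \<Rightarrow> nat \<Rightarrow> complex mat set" where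
  "unitary_mats K p =
     {Q \<in> mats K p p. mat_adjoint Q * Q = 1\<^sub>m p \<and> Q * mat_adjoint Q = 1\<^sub>m p}"

text \<open>
  For a \<^term>\<open>p\<close> by \<^term>\<open>q\<close> matrix the list consists of the \<^term>\<open>min p q\<close> largest of the
  \<^term>\<open>q\<close> square roots of eigenvalues of \<open>B\<^sup>*B\<close>, counted with (algebraic) multiplicity, in
  descending order. The eigenvalues are real and nonnegative, so taking the real part only changes
  the type.
\<close>

definition singular_values :: "complex mat \<Rightarrow> real list" where
  "singular_values B =
     take (min (dim_row B) (dim_col B))
       (rev (sorted_list_of_multiset
         (image_mset (\<lambda>z. sqrt (Re z)) (proots (char_poly (mat_adjoint B * B))))))"

text \<open>Numbered from 1; meaningful for \<open>1 \<le> i \<le> min p q\<close> only.\<close>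

definition sing_val :: "complex mat \<Rightarrow> nat \<Rightarrow> real" where
  "sing_val B i = singular_values B ! (i - 1)"

definition spec_norm :: "complex mat \<Rightarrow> real" where
  "spec_norm B = sing_val B 1"

definition volume :: "complex mat \<Rightarrow> real" where
  "volume B = (\<Prod>i = 1..min (dim_row B) (dim_col B). sing_val B i)"

text \<open>
  The \<^term>\<open>p\<close> by \<^term>\<open>q\<close> matrix with the \<^term>\<open>r\<close> largest singular values of \<^term>\<open>B\<close> on the
  diagonal (all of them if \<^term>\<open>r\<close> is at least their number), and zeros elsewhere.
\<close>

definition sv_mat :: "nat \<Rightarrow> nat \<Rightarrow> nat \<Rightarrow> complex mat \<Rightarrow> complex mat" where
  "sv_mat p q r B =
     mat p q (\<lambda>(i, j). if i = j \<and> i < r then complex_of_real (sing_val B (i + 1)) else 0)"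

definition is_svd :: "complex set \<Rightarrow> complex mat \<Rightarrow> complex mat \<Rightarrow> complex mat \<Rightarrow> bool" where
  "is_svd K B W V \<longleftrightarrow>
     W \<in> unitary_mats K (dim_row B) \<and> V \<in> unitary_mats K (dim_col B) \<and>
     B = W * sv_mat (dim_row B) (dim_col B) (min (dim_row B) (dim_col B)) B * mat_adjoint V"

text \<open>
  The truncated SVD of order \<^term>\<open>k\<close> is not unique if the \<^term>\<open>k\<close>-th and the following singular
  value coincide, hence a relation.
\<close>

definition is_truncated_svd :: "complex set \<Rightarrow> nat \<Rightarrow> complex mat \<Rightarrow> complex mat \<Rightarrow> bool" where
  "is_truncated_svd K k B Bk \<longleftrightarrow>
     (\<exists>W V. is_svd K B W V \<and> Bk = W * sv_mat (dim_row B) (dim_col B) k B * mat_adjoint V)"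

definition is_compact_svd ::
  "complex set \<Rightarrow> complex mat \<Rightarrow> complex mat \<Rightarrow> complex mat \<Rightarrow> complex mat \<Rightarrow> bool" where
  "is_compact_svd K A W S V \<longleftrightarrow>
     W \<in> mats K (dim_row A) (mrank A) \<and> mat_adjoint W * W = 1\<^sub>m (mrank A) \<and>
     V \<in> mats K (dim_col A) (mrank A) \<and> mat_adjoint V * V = 1\<^sub>m (mrank A) \<and>
     S = sv_mat (mrank A) (mrank A) (mrank A) A \<and>
     A = W * S * mat_adjoint V"

definition is_pinv :: "complex mat \<Rightarrow> complex mat \<Rightarrow> bool" where
  "is_pinv B X \<longleftrightarrow>
     X \<in> carrier_mat (dim_col B) (dim_row B) \<and>
     B * X * B = B \<and> X * B * X = X \<and>
     mat_adjoint (B * X) = B * X \<and> mat_adjoint (X * B) = X * B"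

definition pinv :: "complex mat \<Rightarrow> complex mat" where
  "pinv B = (THE X. is_pinv B X)"

definition max_volume_rows :: "complex mat \<Rightarrow> nat set \<Rightarrow> bool" where
  "max_volume_rows W I \<longleftrightarrow>
     (\<forall>I'. I' \<subseteq> {..<dim_row W} \<and> card I' = card I \<longrightarrow>
        volume (submatrix W I' UNIV) \<le> volume (submatrix W I UNIV))"

definition norm_family :: "complex set \<Rightarrow> (complex mat \<Rightarrow> real) \<Rightarrow> bool" where
  "norm_family K nrm \<longleftrightarrow>
     (\<forall>p \<ge> 1. \<forall>q \<ge> 1. \<forall>B \<in> mats K p q.
        0 \<le> nrm B \<and> (nrm B = 0 \<longleftrightarrow> B = 0\<^sub>m p q) \<and>
        (\<forall>c \<in> K. nrm (c \<cdot>\<^sub>m B) = cmod c * nrm B) \<and>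
        (\<forall>D \<in> mats K p q. nrm (B + D) \<le> nrm B + nrm D))"

definition normalized :: "complex set \<Rightarrow> (complex mat \<Rightarrow> real) \<Rightarrow> bool" where
  "normalized K nrm \<longleftrightarrow>
     (\<forall>p \<ge> 1. \<forall>x \<in> mats K p 1. nrm x = sqrt (\<Sum>i<p. (cmod (x $$ (i, 0)))\<^sup>2))"

definition uniformly_generated :: "complex set \<Rightarrow> (complex mat \<Rightarrow> real) \<Rightarrow> bool" where
  "uniformly_generated K nrm \<longleftrightarrow>
     (\<exists>\<phi> :: real list \<Rightarrow> real.
        (\<forall>xs ys. mset xs = mset ys \<longrightarrow> \<phi> xs = \<phi> ys) \<and>
        (\<forall>p \<ge> 1. \<forall>q \<ge> 1. \<forall>B \<in> mats K p q. nrm B = \<phi> (take (mrank B) (singular_values B))))"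

definition unitarily_invariant :: "complex set \<Rightarrow> (complex mat \<Rightarrow> real) \<Rightarrow> bool" where
  "unitarily_invariant K nrm \<longleftrightarrow>
     (\<forall>p \<ge> 1. \<forall>q \<ge> 1. \<forall>B \<in> mats K p q. \<forall>P \<in> unitary_mats K p. \<forall>Q \<in> unitary_mats K q.
        nrm (P * B * Q) = nrm B)"

definition submultiplicative :: "complex set \<Rightarrow> (complex mat \<Rightarrow> real) \<Rightarrow> bool" where
  "submultiplicative K nrm \<longleftrightarrow>
     (\<forall>p \<ge> 1. \<forall>q \<ge> 1. \<forall>r \<ge> 1. \<forall>B \<in> mats K p q. \<forall>D \<in> mats K q r.
        nrm (B * D) \<le> nrm B * nrm D)"

definition pinv_perturbation_constant ::
  "complex set \<Rightarrow> (complex mat \<Rightarrow> real) \<Rightarrow> real \<Rightarrow> bool" where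
  "pinv_perturbation_constant K nrm \<mu> \<longleftrightarrow>
     1 \<le> \<mu> \<and> \<mu> \<le> 3 \<and>
     (\<forall>p \<ge> 1. \<forall>q \<ge> 1. \<forall>B \<in> mats K p q. \<forall>B' \<in> mats K p q.
        (mrank B = mrank B' \<longrightarrow>
           nrm (pinv B - pinv B') \<le>
             \<mu> * spec_norm (pinv B') * spec_norm (pinv B) * nrm (B' - B)) \<and>
        (mrank B \<noteq> mrank B' \<longrightarrow>
           nrm (pinv B - pinv B') \<le>
             \<mu> * max ((spec_norm (pinv B'))\<^sup>2) ((spec_norm (pinv B))\<^sup>2) * nrm (B' - B)))"

end

theory Submission
  imports Defs "HOL-Analysis.L2_Norm"
begin

text \<open>
  Why the theorem holds. Write \<open>C = A T\<close>, \<open>R = H\<^sup>* A\<close> and \<open>U = H\<^sup>* A T\<close> with the 0-1 matrices \<open>T\<close> and \<open>H\<close>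
  that select the columns in \<open>J\<close> and the rows in \<open>I\<close>.

  The role of the volumes is to make \<open>A\<close> stably recoverable from its selected columns and rows: there
  are \<open>X\<close> and \<open>Y\<close> of operator norm at most \<open>t\<close> with \<open>A = C Y = X R\<close>. Because \<open>V\<close> has orthonormal columns,
  \<open>Y\<close> can be taken as the pseudoinverse of \<open>V\<^sub>J\<^sup>*\<close> times \<open>V\<^sup>*\<close>, and the bound says that the squared smallest
  singular value of \<open>V\<^sub>J\<close> is at least \<open>1 / t\<^sup>2\<close>. To see this, add a row \<open>j\<close> to \<open>J\<close>. Among the rows of the
  enlarged matrix, \<open>j\<close> has the smallest leverage score, since deleting any other row instead does not
  leave a larger volume; as the leverage scores add up to \<open>k\<close>, that of \<open>j\<close> is at most \<open>k / (card J + 1)\<close>.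
  Summation over all rows outside \<open>J\<close> gives \<open>t\<close> (\<open>max_volume_row_bound\<close>, \<open>max_volume_interpolation\<close>).

  Given \<open>X\<close> and \<open>Y\<close>, both estimates are algebra with three rules for the norm: operator bounds of
  outer factors can be pulled out of \<open>X B Y\<close> (\<open>nrm_product_le\<close>), truncation to rank \<open>k\<close> is a best
  approximation, so that truncating \<open>B + F\<close> for \<open>B\<close> of rank at most \<open>k\<close> costs at most twice the norm of
  \<open>F\<close> (\<open>truncation_error\<close>), and the spectral norm is the smallest one (\<open>op_bound_nrm\<close>). The first
  estimate (\<open>projection_bound\<close>) is obtained with the constant \<open>4 t + 1\<close>. In the second one
  (\<open>cur_bound\<close>), the identity \<open>A - C D R = X (U - U D U) Y\<close> for \<open>D\<close> the pseudoinverse of the truncated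
  perturbed core matrix avoids a comparison of \<open>D\<close> with the pseudoinverse of \<open>U\<close>; the constants
  come out as stated.

  All three rules are instances of one principle: if the singular values of \<open>B\<close> are dominated by those
  of \<open>D\<close>, then so is the norm (\<open>nrm_dominated\<close>). As the norm is uniformly generated, only real diagonal
  matrices have to be compared, and these by reversing signs of entries. Inequalities between singular
  values are in turn read off from their description as approximation numbers (\<open>sigma_le_iff\<close>):
  \<open>\<sigma>\<^sub>i(B) \<le> c\<close>, counting from 0, if and only if some product of a \<open>p \<times> i\<close> and an \<open>i \<times> q\<close> matrix differs from
  \<open>B\<close> by a matrix of operator norm at most \<open>c\<close>. This description refers to complex matrices also if
  \<open>K = \<real>\<close>, so that diagonalization of Hermitian complex matrices suffices for both scalar fields.
\<close>

section \<open>Matrix algebra and the Euclidean norm\<close>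

lemma dim_mat_adjoint [simp]:
  "dim_row (mat_adjoint A) = dim_col A" "dim_col (mat_adjoint A) = dim_row A"
  by (auto simp: mat_adjoint_def)

lemma index_mat_adjoint [simp]:
  assumes "i < dim_col A" "j < dim_row A"
  shows "mat_adjoint A $$ (i, j) = conjugate (A $$ (j, i))"
proof -
  have "mat_adjoint A $$ (i, j) = conjugate (col A i) $ j"
    using assms by (simp add: mat_adjoint_def mat_of_rows_index)
  then show ?thesis using assms by simp
qed

lemma mat_adjoint_carrier [simp]: "A \<in> carrier_mat p q \<Longrightarrow> mat_adjoint A \<in> carrier_mat q p"
  by (auto intro!: carrier_matI)

lemma mat_adjoint_adjoint [simp]: "mat_adjoint (mat_adjoint A) = A"
  by (rule eq_matI) auto

lemma mat_adjoint_one [simp]: "mat_adjoint (1\<^sub>m n) = (1\<^sub>m n :: complex mat)"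
  by (rule eq_matI) auto

lemma mat_adjoint_mult:
  fixes A B :: "complex mat"
  assumes "dim_col A = dim_row B"
  shows "mat_adjoint (A * B) = mat_adjoint B * mat_adjoint A"
  by (rule eq_matI) (use assms in \<open>auto simp: scalar_prod_def mult.commute intro!: sum.cong\<close>)

lemma mat_adjoint_minus:
  fixes A B :: "complex mat"
  assumes "dim_row A = dim_row B" "dim_col A = dim_col B"
  shows "mat_adjoint (A - B) = mat_adjoint A - mat_adjoint B"
  by (rule eq_matI) (use assms in auto)

text \<open>Associativity and distributivity with side conditions on dimensions only, so that the
  simplifier can discharge them.\<close>

lemma mat_assoc:
  fixes A B C :: "complex mat"
  assumes "dim_col A = dim_row B" "dim_col B = dim_row C"
  shows "A * B * C = A * (B * C)"
  by (rule assoc_mult_mat[of _ "dim_row A" "dim_row B" _ "dim_row C" _ "dim_col C"])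
     (use assms in \<open>auto intro!: carrier_matI\<close>)

lemma mat_assoc_vec:
  fixes A B :: "complex mat"
  assumes "dim_col A = dim_row B" "dim_col B = dim_vec x"
  shows "A * B *\<^sub>v x = A *\<^sub>v (B *\<^sub>v x)"
  by (rule assoc_mult_mat_vec[of _ "dim_row A" "dim_row B" _ "dim_vec x"])
     (use assms in \<open>auto intro!: carrier_matI carrier_vecI\<close>)

lemma mat_cancel:
  fixes X Y C :: "complex mat"
  assumes "X * Y = 1\<^sub>m n" "dim_col X = dim_row Y" "dim_col Y = dim_row C" "dim_row C = n"
  shows "X * (Y * C) = C"
proof -
  have "X * (Y * C) = X * Y * C" using assms by (intro mat_assoc[symmetric]) auto
  then show ?thesis using assms by (metis carrier_matI left_mult_one_mat)
qed

lemma mat_cancel_vec: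
  fixes X Y :: "complex mat"
  assumes "X * Y = 1\<^sub>m n" "dim_col X = dim_row Y" "dim_col Y = dim_vec x" "dim_vec x = n"
  shows "X *\<^sub>v (Y *\<^sub>v x) = x"
proof -
  have "X *\<^sub>v (Y *\<^sub>v x) = X * Y *\<^sub>v x" using assms by (intro mat_assoc_vec[symmetric]) auto
  then show ?thesis using assms by (metis carrier_vecI one_mult_mat_vec)
qed

lemma mat_distribs:
  fixes A B C :: "complex mat"
  shows "dim_row A = dim_row B \<Longrightarrow> dim_col A = dim_col B \<Longrightarrow> dim_col B = dim_row C \<Longrightarrow>
      (A + B) * C = A * C + B * C"
    and "dim_row A = dim_row B \<Longrightarrow> dim_col A = dim_col B \<Longrightarrow> dim_col B = dim_row C \<Longrightarrow>
      (A - B) * C = A * C - B * C"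
    and "dim_row A = dim_row B \<Longrightarrow> dim_col A = dim_col B \<Longrightarrow> dim_col C = dim_row B \<Longrightarrow>
      C * (A + B) = C * A + C * B"
    and "dim_row A = dim_row B \<Longrightarrow> dim_col A = dim_col B \<Longrightarrow> dim_col C = dim_row B \<Longrightarrow>
      C * (A - B) = C * A - C * B"
  by ((rule add_mult_distrib_mat minus_mult_distrib_mat mult_add_distrib_mat mult_minus_distrib_mat;
    auto intro!: carrier_matI)+)

lemma mat_distribs_vec:
  fixes A B :: "complex mat"
  shows "dim_row A = dim_row B \<Longrightarrow> dim_col A = dim_col B \<Longrightarrow> dim_col B = dim_vec x \<Longrightarrow>
      (A + B) *\<^sub>v x = A *\<^sub>v x + B *\<^sub>v x"
    and "dim_row A = dim_row B \<Longrightarrow> dim_col A = dim_col B \<Longrightarrow> dim_col B = dim_vec x \<Longrightarrow>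
      (A - B) *\<^sub>v x = A *\<^sub>v x - B *\<^sub>v x"
  by ((rule add_mult_distrib_mat_vec minus_mult_distrib_mat_vec;
    auto intro!: carrier_matI carrier_vecI)+)

lemma mat_mult_index:
  assumes "i < dim_row A" "j < dim_col B" "dim_col A = dim_row B"
  shows "(A * B) $$ (i, j) = (\<Sum>l<dim_row B. A $$ (i, l) * B $$ (l, j))"
  using assms by (auto simp: scalar_prod_def atLeast0LessThan intro!: sum.cong)

lemma mat_mult_vec_index:
  assumes "i < dim_row A" "dim_col A = dim_vec x"
  shows "(A *\<^sub>v x) $ i = (\<Sum>j<dim_vec x. A $$ (i, j) * x $ j)"
  using assms by (auto simp: scalar_prod_def atLeast0LessThan intro!: sum.cong)

definition vnorm :: "complex vec \<Rightarrow> real" where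
  "vnorm x = L2_set (\<lambda>i. cmod (x $ i)) {..<dim_vec x}"

lemma vnorm_nonneg [simp]: "0 \<le> vnorm x"
  by (simp add: vnorm_def L2_set_nonneg)

lemma vnorm_sq: "(vnorm x)\<^sup>2 = (\<Sum>i<dim_vec x. (cmod (x $ i))\<^sup>2)"
  by (simp add: vnorm_def L2_set_def sum_nonneg)

lemma cinner_self: "x \<bullet>c x = complex_of_real ((vnorm x)\<^sup>2)"
  unfolding vnorm_sq scalar_prod_def of_real_sum
  by (rule sum.cong) (auto simp: complex_norm_square[symmetric] simp del: of_real_power)

lemma vnorm_triangle: "dim_vec x = dim_vec y \<Longrightarrow> vnorm (x + y) \<le> vnorm x + vnorm y"
proof -
  assume d: "dim_vec x = dim_vec y"
  have "vnorm (x + y) = L2_set (\<lambda>i. cmod (x $ i + y $ i)) {..<dim_vec y}"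
    unfolding vnorm_def L2_set_def by (auto intro!: sum.cong)
  also have "\<dots> \<le> L2_set (\<lambda>i. cmod (x $ i) + cmod (y $ i)) {..<dim_vec y}"
    by (rule L2_set_mono) (auto intro: norm_triangle_ineq)
  also have "\<dots> \<le> L2_set (\<lambda>i. cmod (x $ i)) {..<dim_vec y} + L2_set (\<lambda>i. cmod (y $ i)) {..<dim_vec y}"
    by (rule L2_set_triangle_ineq)
  finally show ?thesis by (simp add: vnorm_def d)
qed

lemma vnorm_smult [simp]: "vnorm (c \<cdot>\<^sub>v x) = cmod c * vnorm x"
proof -
  have "vnorm (c \<cdot>\<^sub>v x) = L2_set (\<lambda>i. cmod c * cmod (x $ i)) {..<dim_vec x}"
    unfolding vnorm_def L2_set_def by (auto simp: norm_mult intro!: sum.cong)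
  then show ?thesis by (simp add: vnorm_def L2_set_right_distrib)
qed

lemma vnorm_eq_0: "vnorm x = 0 \<longleftrightarrow> x = 0\<^sub>v (dim_vec x)"
  unfolding vnorm_def by (subst L2_set_eq_0_iff) (auto simp: vec_eq_iff)

lemma vnorm_zero [simp]: "vnorm (0\<^sub>v n) = 0"
  by (simp add: vnorm_eq_0)

lemma vnorm_triangle_minus: "dim_vec x = dim_vec y \<Longrightarrow> vnorm (x - y) \<le> vnorm x + vnorm y"
proof -
  assume d: "dim_vec x = dim_vec y"
  have "x - y = x + (-1) \<cdot>\<^sub>v y" by (rule eq_vecI) (use d in auto)
  then show ?thesis using vnorm_triangle[of x "(-1) \<cdot>\<^sub>v y"] d by simp
qed

lemma cauchy_schwarz:
  assumes "dim_vec x = dim_vec y"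
  shows "cmod (x \<bullet>c y) \<le> vnorm x * vnorm y"
proof -
  have "cmod (x \<bullet>c y) \<le> (\<Sum>i<dim_vec y. \<bar>cmod (x $ i)\<bar> * \<bar>cmod (y $ i)\<bar>)"
    unfolding scalar_prod_def
    by (rule order_trans[OF norm_sum]) (auto simp: norm_mult atLeast0LessThan)
  also have "\<dots> \<le> vnorm x * vnorm y"
    unfolding vnorm_def assms by (rule L2_set_mult_ineq)
  finally show ?thesis .
qed

lemma mat_adjoint_cinner:
  fixes A :: "complex mat"
  assumes "dim_vec x = dim_col A" "dim_vec y = dim_row A"
  shows "(A *\<^sub>v x) \<bullet>c y = x \<bullet>c (mat_adjoint A *\<^sub>v y)"
proof -
  have "(A *\<^sub>v x) \<bullet>c y = (\<Sum>i<dim_row A. \<Sum>j<dim_col A. A $$ (i, j) * x $ j * cnj (y $ i))"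
    using assms by (simp add: scalar_prod_def sum_distrib_right atLeast0LessThan)
  also have "\<dots> = (\<Sum>j<dim_col A. \<Sum>i<dim_row A. A $$ (i, j) * x $ j * cnj (y $ i))"
    by (rule sum.swap)
  also have "\<dots> = x \<bullet>c (mat_adjoint A *\<^sub>v y)"
    using assms by (auto simp: scalar_prod_def sum_distrib_left atLeast0LessThan mult_ac intro!: sum.cong)
  finally show ?thesis .
qed

text \<open>A number \<open>c\<close> is a bound for the operator norm of \<open>X\<close>. Bounds, rather than the operator norm
  itself, are all that is needed, and they are available for matrices without columns as well.\<close>

definition op_bound :: "complex mat \<Rightarrow> real \<Rightarrow> bool" where
  "op_bound X c \<longleftrightarrow> 0 \<le> c \<and> (\<forall>x \<in> carrier_vec (dim_col X). vnorm (X *\<^sub>v x) \<le> c * vnorm x)"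

lemma op_boundD: "op_bound X c \<Longrightarrow> dim_vec x = dim_col X \<Longrightarrow> vnorm (X *\<^sub>v x) \<le> c * vnorm x"
  by (auto simp: op_bound_def intro!: carrier_vecI)

lemma op_bound_mono: "op_bound X c \<Longrightarrow> c \<le> d \<Longrightarrow> op_bound X d"
  unfolding op_bound_def by (meson mult_right_mono order_trans vnorm_nonneg)

lemma op_bound_mult:
  assumes "op_bound X c" "op_bound Y d" "dim_col X = dim_row Y"
  shows "op_bound (X * Y) (c * d)"
  unfolding op_bound_def
proof (intro conjI ballI)
  show "0 \<le> c * d" using assms by (auto simp: op_bound_def)
  fix x :: "complex vec" assume "x \<in> carrier_vec (dim_col (X * Y))"
  then have d: "dim_vec x = dim_col Y" by auto
  then have "vnorm (X * Y *\<^sub>v x) = vnorm (X *\<^sub>v (Y *\<^sub>v x))"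
    using assms(3) by (simp add: mat_assoc_vec)
  also have "\<dots> \<le> c * vnorm (Y *\<^sub>v x)" using op_boundD[OF assms(1)] assms(3) by simp
  also have "\<dots> \<le> c * (d * vnorm x)"
    using op_boundD[OF assms(2) d] assms(1) by (auto simp: op_bound_def intro: mult_left_mono)
  finally show "vnorm (X * Y *\<^sub>v x) \<le> c * d * vnorm x" by (simp add: mult_ac)
qed

lemma op_bound_add:
  assumes "op_bound X c" "op_bound Y d" "dim_row X = dim_row Y" "dim_col X = dim_col Y"
  shows "op_bound (X + Y) (c + d)"
  unfolding op_bound_def
proof (intro conjI ballI)
  show "0 \<le> c + d" using assms by (auto simp: op_bound_def)
  fix x :: "complex vec" assume "x \<in> carrier_vec (dim_col (X + Y))"
  then have d: "dim_vec x = dim_col Y" by auto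
  then have "vnorm ((X + Y) *\<^sub>v x) \<le> vnorm (X *\<^sub>v x) + vnorm (Y *\<^sub>v x)"
    using vnorm_triangle[of "X *\<^sub>v x" "Y *\<^sub>v x"] assms by (simp add: mat_distribs_vec)
  then show "vnorm ((X + Y) *\<^sub>v x) \<le> (c + d) * vnorm x"
    using op_boundD[OF assms(1), of x] op_boundD[OF assms(2) d] d assms(4)
    by (simp add: distrib_right)
qed

lemma op_bound_minus:
  assumes "op_bound X c" "op_bound Y d" "dim_row X = dim_row Y" "dim_col X = dim_col Y"
  shows "op_bound (X - Y) (c + d)"
  unfolding op_bound_def
proof (intro conjI ballI)
  show "0 \<le> c + d" using assms by (auto simp: op_bound_def)
  fix x :: "complex vec" assume "x \<in> carrier_vec (dim_col (X - Y))"
  then have d: "dim_vec x = dim_col Y" by auto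
  then have "vnorm ((X - Y) *\<^sub>v x) \<le> vnorm (X *\<^sub>v x) + vnorm (Y *\<^sub>v x)"
    using vnorm_triangle_minus[of "X *\<^sub>v x" "Y *\<^sub>v x"] assms by (simp add: mat_distribs_vec)
  then show "vnorm ((X - Y) *\<^sub>v x) \<le> (c + d) * vnorm x"
    using op_boundD[OF assms(1), of x] op_boundD[OF assms(2) d] d assms(4)
    by (simp add: distrib_right)
qed

lemma op_bound_one: "op_bound (1\<^sub>m n) 1"
  by (auto simp: op_bound_def)

text \<open>If \<open>vnorm y\<^sup>2 = \<langle>x, z\<rangle>\<close>, a bound of \<open>z\<close> in terms of \<open>y\<close> gives one of \<open>y\<close> in terms of \<open>x\<close>. This
  single argument covers adjoints and orthogonal projections.\<close>

lemma vnorm_le_of_cinner: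
  assumes "y \<bullet>c y = x \<bullet>c z" "dim_vec x = dim_vec z" "vnorm z \<le> c * vnorm y" "0 \<le> c"
  shows "vnorm y \<le> c * vnorm x"
proof (cases "vnorm y = 0")
  case False
  have "(vnorm y)\<^sup>2 = cmod (x \<bullet>c z)"
    by (simp add: cinner_self norm_power flip: assms(1))
  also have "\<dots> \<le> vnorm x * (c * vnorm y)"
    using cauchy_schwarz[OF assms(2)] assms(3) by (meson mult_left_mono order_trans vnorm_nonneg)
  finally have "vnorm y * vnorm y \<le> (c * vnorm x) * vnorm y"
    by (simp add: power2_eq_square mult_ac)
  then show ?thesis using False vnorm_nonneg[of y] by (simp add: mult_le_cancel_right)
qed (use assms in simp)

lemma op_bound_adjoint:
  assumes "op_bound X c"
  shows "op_bound (mat_adjoint X) c"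
  unfolding op_bound_def
proof (intro conjI ballI)
  show c: "0 \<le> c" using assms by (auto simp: op_bound_def)
  fix x :: "complex vec" assume "x \<in> carrier_vec (dim_col (mat_adjoint X))"
  then have d: "dim_vec x = dim_row X" by auto
  let ?y = "mat_adjoint X *\<^sub>v x"
  have "?y \<bullet>c ?y = x \<bullet>c (X *\<^sub>v ?y)"
    using mat_adjoint_cinner[of x "mat_adjoint X" ?y] d by simp
  then show "vnorm ?y \<le> c * vnorm x"
    by (rule vnorm_le_of_cinner) (use d c op_boundD[OF assms, of ?y] in auto)
qed

lemma op_bound_projection:
  fixes P :: "complex mat"
  assumes "P \<in> carrier_mat n n" "mat_adjoint P = P" "P * P = P"
  shows "op_bound P 1"
  unfolding op_bound_def
proof (intro conjI ballI)
  fix x :: "complex vec" assume "x \<in> carrier_vec (dim_col P)"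
  then have d: "dim_vec x = n" using assms by auto
  have "(P *\<^sub>v x) \<bullet>c (P *\<^sub>v x) = x \<bullet>c (P *\<^sub>v (P *\<^sub>v x))"
    using mat_adjoint_cinner[of x P "P *\<^sub>v x"] d assms by simp
  also have "P *\<^sub>v (P *\<^sub>v x) = P *\<^sub>v x"
    using mat_assoc_vec[of P P x] assms d by auto
  finally show "vnorm (P *\<^sub>v x) \<le> 1 * vnorm x"
    by (rule vnorm_le_of_cinner) (use d assms in auto)
qed simp

lemma op_bound_projection_compl:
  fixes P :: "complex mat"
  assumes P: "P \<in> carrier_mat n n" "mat_adjoint P = P" "P * P = P"
  shows "op_bound (1\<^sub>m n - P) 1"
proof (rule op_bound_projection)
  show "(1\<^sub>m n - P) * (1\<^sub>m n - P) = 1\<^sub>m n - P"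
  proof -
    have "(1\<^sub>m n - P) * (1\<^sub>m n - P) = (1\<^sub>m n - P) - (P - P)"
      using P by (simp add: mat_distribs)
    also have "\<dots> = 1\<^sub>m n - P" by (rule eq_matI) (use P in auto)
    finally show ?thesis .
  qed
qed (use P in \<open>auto simp: mat_adjoint_minus\<close>)

lemma vnorm_isometry:
  fixes X :: "complex mat"
  assumes "mat_adjoint X * X = 1\<^sub>m (dim_col X)" "dim_vec x = dim_col X"
  shows "vnorm (X *\<^sub>v x) = vnorm x"
proof -
  have "(X *\<^sub>v x) \<bullet>c (X *\<^sub>v x) = x \<bullet>c (mat_adjoint X *\<^sub>v (X *\<^sub>v x))"
    using assms by (subst mat_adjoint_cinner) auto
  also have "mat_adjoint X *\<^sub>v (X *\<^sub>v x) = mat_adjoint X * X *\<^sub>v x"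
    using assms(2) by (subst mat_assoc_vec) auto
  also have "\<dots> = x" unfolding assms(1) by (rule one_mult_mat_vec[OF carrier_vecI[OF assms(2)]])
  finally have "(vnorm (X *\<^sub>v x))\<^sup>2 = (vnorm x)\<^sup>2"
    unfolding cinner_self using of_real_eq_iff by blast
  then show ?thesis using vnorm_nonneg power2_eq_iff_nonneg by blast
qed

lemma op_bound_isometry: "mat_adjoint X * X = 1\<^sub>m (dim_col X) \<Longrightarrow> op_bound X 1"
  by (auto simp: op_bound_def vnorm_isometry)

text \<open>Diagonal matrices need not be square, so that singular value decompositions of rectangular
  matrices are covered.\<close>

definition rdiag :: "nat \<Rightarrow> nat \<Rightarrow> (nat \<Rightarrow> real) \<Rightarrow> complex mat" where
  "rdiag p q s = mat p q (\<lambda>(i, j). if i = j then complex_of_real (s i) else 0)"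

lemma rdiag_dim [simp]: "dim_row (rdiag p q s) = p" "dim_col (rdiag p q s) = q"
  by (auto simp: rdiag_def)

lemma rdiag_index [simp]:
  "i < p \<Longrightarrow> j < q \<Longrightarrow> rdiag p q s $$ (i, j) = (if i = j then complex_of_real (s i) else 0)"
  by (auto simp: rdiag_def)

lemma rdiag_carrier [simp]: "rdiag p q s \<in> carrier_mat p q"
  by (auto intro!: carrier_matI)

lemma rdiag_cong: "(\<And>i. i < p \<Longrightarrow> i < q \<Longrightarrow> s i = s' i) \<Longrightarrow> rdiag p q s = rdiag p q s'"
  by (rule eq_matI) auto

lemma rdiag_adjoint [simp]: "mat_adjoint (rdiag p q s) = rdiag q p s"
  by (rule eq_matI) auto

lemma rdiag_minus: "rdiag p q s - rdiag p q s' = rdiag p q (\<lambda>i. s i - s' i)"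
  by (rule eq_matI) auto

lemma rdiag_mult_vec:
  assumes "dim_vec x = q"
  shows "rdiag p q s *\<^sub>v x = vec p (\<lambda>i. if i < q then of_real (s i) * x $ i else 0)"
proof (rule eq_vecI)
  fix i assume "i < dim_vec (vec p (\<lambda>i. if i < q then of_real (s i) * x $ i else 0))"
  then have i: "i < p" by simp
  have "(rdiag p q s *\<^sub>v x) $ i = (\<Sum>j<q. rdiag p q s $$ (i, j) * x $ j)"
    using i assms by (subst mat_mult_vec_index) auto
  also have "\<dots> = (\<Sum>j<q. if i = j then of_real (s i) * x $ j else 0)"
    by (rule sum.cong) (use i in auto)
  finally have "(rdiag p q s *\<^sub>v x) $ i = (if i < q then of_real (s i) * x $ i else 0)" by simp
  then show "(rdiag p q s *\<^sub>v x) $ i = vec p (\<lambda>i. if i < q then of_real (s i) * x $ i else 0) $ i"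
    using i by simp
qed simp

lemma rdiag_mult: "rdiag p q s * rdiag q r s' = rdiag p r (\<lambda>i. if i < q then s i * s' i else 0)"
proof (rule eq_matI)
  fix i j assume "i < dim_row (rdiag p r (\<lambda>i. if i < q then s i * s' i else 0))"
    "j < dim_col (rdiag p r (\<lambda>i. if i < q then s i * s' i else 0))"
  then have ij: "i < p" "j < r" by auto
  have "(rdiag p q s * rdiag q r s') $$ (i, j)
      = (\<Sum>l<q. rdiag p q s $$ (i, l) * rdiag q r s' $$ (l, j))"
    using ij by (subst mat_mult_index) auto
  also have "\<dots> = (\<Sum>l<q. if i = l then (if i = j then of_real (s i * s' i) else 0) else 0)"
    by (rule sum.cong) (use ij in auto)
  finally have "(rdiag p q s * rdiag q r s') $$ (i, j)
      = (if i < q then (if i = j then of_real (s i * s' i) else 0) else 0)" by simp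
  then show "(rdiag p q s * rdiag q r s') $$ (i, j)
      = rdiag p r (\<lambda>i. if i < q then s i * s' i else 0) $$ (i, j)"
    using ij by simp
qed auto

lemma op_bound_rdiag:
  assumes "\<And>i. i < p \<Longrightarrow> i < q \<Longrightarrow> \<bar>s i\<bar> \<le> c" "0 \<le> c"
  shows "op_bound (rdiag p q s) c"
  unfolding op_bound_def
proof (intro conjI ballI)
  fix x :: "complex vec" assume "x \<in> carrier_vec (dim_col (rdiag p q s))"
  then have x: "dim_vec x = q" by auto
  have "(vnorm (rdiag p q s *\<^sub>v x))\<^sup>2 = (\<Sum>i<p. if i < q then (s i)\<^sup>2 * (cmod (x $ i))\<^sup>2 else 0)"
    by (auto simp: vnorm_sq rdiag_mult_vec[OF x] norm_mult power_mult_distrib intro!: sum.cong)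
  also have "\<dots> = (\<Sum>i\<in>{..<p} \<inter> {..<q}. (s i)\<^sup>2 * (cmod (x $ i))\<^sup>2)"
    by (subst sum.inter_restrict) auto
  also have "\<dots> \<le> (\<Sum>i\<in>{..<p} \<inter> {..<q}. c\<^sup>2 * (cmod (x $ i))\<^sup>2)"
    using assms by (intro sum_mono mult_right_mono) (auto intro!: power2_le_iff_abs_le[THEN iffD2])
  also have "\<dots> \<le> (\<Sum>i<q. c\<^sup>2 * (cmod (x $ i))\<^sup>2)"
    by (rule sum_mono2) auto
  also have "\<dots> = (c * vnorm x)\<^sup>2"
    by (simp add: power_mult_distrib vnorm_sq x sum_distrib_left)
  finally show "vnorm (rdiag p q s *\<^sub>v x) \<le> c * vnorm x"
    by (rule power2_le_imp_le) (use assms(2) in simp)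
qed (use assms in auto)

section \<open>Unitary diagonalization of Hermitian matrices\<close>

lemma unitary_with_first_column:
  fixes v :: "complex vec"
  assumes v: "v \<in> carrier_vec n" "v \<noteq> 0\<^sub>v n"
  obtains W c where "W \<in> carrier_mat n n" "mat_adjoint W * W = 1\<^sub>m n" "col W 0 = c \<cdot>\<^sub>v v"
proof -
  interpret cof_vec_space n "TYPE(complex)" .
  have n0: "n \<noteq> 0" using v by (auto simp: vec_eq_iff)
  let ?b = "basis_completion v"
  define ws where "ws = gram_schmidt n ?b"
  note bc = basis_completion[OF v]
  from gram_schmidt_result[OF bc(2) bc(4) bc(5) ws_def] bc(6)
  have ws: "set ws \<subseteq> carrier_vec n" "corthogonal ws" "length ws = n" by auto
  obtain vs where b: "?b = v # vs" using bc(6,7) n0 by (cases ?b) auto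
  have hd: "hd ws = v" unfolding ws_def b using v by simp
  define us where "us = map (\<lambda>w. complex_of_real (1 / vnorm w) \<cdot>\<^sub>v w) ws"
  define W where "W = mat_of_cols n us"
  have W: "W \<in> carrier_mat n n" by (auto simp: W_def us_def ws)
  have wsc: "i < n \<Longrightarrow> ws ! i \<in> carrier_vec n" for i using ws by auto
  have colW: "col W i = complex_of_real (1 / vnorm (ws ! i)) \<cdot>\<^sub>v ws ! i" if "i < n" for i
    unfolding W_def us_def using that ws wsc by (subst col_mat_of_cols) auto
  have "mat_adjoint W * W = 1\<^sub>m n"
  proof (rule eq_matI)
    fix i j assume "i < dim_row (1\<^sub>m n :: complex mat)" "j < dim_col (1\<^sub>m n :: complex mat)"
    then have ij: "i < n" "j < n" by auto
    have "(mat_adjoint W * W) $$ (i, j) = (\<Sum>l<n. cnj (col W i $ l) * (col W j $ l))"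
      using W ij by (subst mat_mult_index) auto
    also have "\<dots> = complex_of_real (1 / vnorm (ws ! i) * (1 / vnorm (ws ! j))) * (ws ! j \<bullet>c ws ! i)"
      using ij wsc[of i] wsc[of j]
      by (auto simp: colW scalar_prod_def sum_distrib_left atLeast0LessThan mult_ac intro!: sum.cong)
    also have "\<dots> = (if i = j then 1 else 0)"
    proof (cases "i = j")
      case True
      have "ws ! i \<bullet>c ws ! i \<noteq> 0" using corthogonalD[OF ws(2), of i i] ij ws(3) by auto
      then have "vnorm (ws ! i) \<noteq> 0" by (auto simp: cinner_self)
      then show ?thesis using True by (simp add: cinner_self power2_eq_square)
    next
      case False
      then have "ws ! j \<bullet>c ws ! i = 0" using corthogonalD[OF ws(2), of j i] ij ws(3) by auto
      then show ?thesis using False by simp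
    qed
    finally show "(mat_adjoint W * W) $$ (i, j) = 1\<^sub>m n $$ (i, j)" using ij by simp
  qed (use W in auto)
  moreover have "col W 0 = complex_of_real (1 / vnorm v) \<cdot>\<^sub>v v"
  proof -
    have "ws ! 0 = v" using hd n0 ws(3) by (cases ws) auto
    then show ?thesis using colW[of 0] n0 by simp
  qed
  ultimately show ?thesis using that W by blast
qed

lemma block_diagonal_mult:
  fixes X Y :: "complex mat"
  assumes "X \<in> carrier_mat l l" "X' \<in> carrier_mat l l" "Y \<in> carrier_mat m m" "Y' \<in> carrier_mat m m"
  shows "four_block_mat X (0\<^sub>m l m) (0\<^sub>m m l) Y * four_block_mat X' (0\<^sub>m l m) (0\<^sub>m m l) Y'
       = four_block_mat (X * X') (0\<^sub>m l m) (0\<^sub>m m l) (Y * Y')"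
  by (subst mult_four_block_mat[of _ l l _ m _ m _ _ l _ m]) (use assms in auto)

text \<open>The eigenvalues are prescribed as a list, in any order; later they are listed in descending
  order. The induction splits off the first of them: in an orthonormal basis whose first vector is
  an eigenvector, a Hermitian matrix is block diagonal.\<close>

theorem hermitian_diagonalization:
  fixes A :: "complex mat"
  assumes "A \<in> carrier_mat n n" "mat_adjoint A = A"
    and "char_poly A = (\<Prod>r\<leftarrow>rs. [:- complex_of_real r, 1:])"
  shows "\<exists>Q \<in> carrier_mat n n. mat_adjoint Q * Q = 1\<^sub>m n \<and>
           mat_adjoint Q * A * Q = rdiag n n (\<lambda>i. rs ! i)"
  using assms
proof (induction rs arbitrary: n A)
  case Nil
  then have "n = 0" using degree_monic_char_poly[of A n] by auto
  then show ?case using Nil by (intro bexI[of _ "1\<^sub>m 0"]) (auto intro!: eq_matI)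
next
  case (Cons r rs n A)
  let ?e = "complex_of_real r"
  note A = Cons.prems(1,2)
  have cp: "char_poly A = [:- ?e, 1:] * (\<Prod>r\<leftarrow>rs. [:- complex_of_real r, 1:])"
    using Cons.prems(3) by simp
  then have "poly (char_poly A) ?e = 0" by simp
  then have "eigenvalue A ?e" using eigenvalue_root_char_poly[OF A(1)] by simp
  then obtain v where v: "v \<in> carrier_vec n" "v \<noteq> 0\<^sub>v n" "A *\<^sub>v v = ?e \<cdot>\<^sub>v v"
    using A by (auto simp: eigenvalue_def eigenvector_def)
  obtain W c where W: "W \<in> carrier_mat n n" "mat_adjoint W * W = 1\<^sub>m n" "col W 0 = c \<cdot>\<^sub>v v"
    using unitary_with_first_column[OF v(1,2)] by metis
  have WW: "W * mat_adjoint W = 1\<^sub>m n"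
    using mat_mult_left_right_inverse[of "mat_adjoint W" n W] W by simp
  have n0: "n \<noteq> 0" using v by (auto simp: vec_eq_iff)
  then obtain m where n: "n = Suc m" by (cases n) auto
  define A' where "A' = mat_adjoint W * A * W"
  have A': "A' \<in> carrier_mat n n" using W A by (auto simp: A'_def intro!: carrier_matI)
  have herm: "mat_adjoint A' = A'"
    using W A by (simp add: A'_def mat_adjoint_mult mat_assoc)
  have AW: "col (A * W) 0 = ?e \<cdot>\<^sub>v col W 0"
  proof -
    have "col (A * W) 0 = A *\<^sub>v col W 0" using A W n0 by (intro eq_vecI) auto
    also have "\<dots> = c \<cdot>\<^sub>v (A *\<^sub>v v)" unfolding W(3) using A v by (simp add: mult_mat_vec)
    also have "\<dots> = ?e \<cdot>\<^sub>v col W 0" unfolding v(3) W(3) by (simp add: smult_smult_assoc mult.commute)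
    finally show ?thesis .
  qed
  have A'0: "A' $$ (i, 0) = (if i = 0 then ?e else 0)" if i: "i < n" for i
  proof -
    have "A' $$ (i, 0) = (mat_adjoint W * (A * W)) $$ (i, 0)"
      using A W by (simp add: A'_def mat_assoc)
    also have "\<dots> = (\<Sum>l<n. mat_adjoint W $$ (i, l) * col (A * W) 0 $ l)"
      using A W i n0 by (subst mat_mult_index) auto
    also have "\<dots> = ?e * (\<Sum>l<n. mat_adjoint W $$ (i, l) * W $$ (l, 0))"
      unfolding AW sum_distrib_left using W(1) n0 by (intro sum.cong) auto
    also have "(\<Sum>l<n. mat_adjoint W $$ (i, l) * W $$ (l, 0)) = (mat_adjoint W * W) $$ (i, 0)"
      using W i n0 by (subst mat_mult_index) auto
    finally show ?thesis using W i n0 by simp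
  qed
  have A'0': "A' $$ (0, j) = (if j = 0 then ?e else 0)" if j: "j < n" for j
  proof -
    have "A' $$ (0, j) = cnj (A' $$ (j, 0))"
      using index_mat_adjoint[of 0 A' j] A' j n0 by (simp add: herm)
    then show ?thesis using A'0[OF j] by simp
  qed
  define B where "B = mat m m (\<lambda>(i, j). A' $$ (Suc i, Suc j))"
  have B: "B \<in> carrier_mat m m" by (simp add: B_def)
  have A'B: "A' = four_block_mat (rdiag 1 1 (\<lambda>_. r)) (0\<^sub>m 1 m) (0\<^sub>m m 1) B"
  proof (rule eq_matI)
    fix i j assume "i < dim_row (four_block_mat (rdiag 1 1 (\<lambda>_. r)) (0\<^sub>m 1 m) (0\<^sub>m m 1) B)"
      "j < dim_col (four_block_mat (rdiag 1 1 (\<lambda>_. r)) (0\<^sub>m 1 m) (0\<^sub>m m 1) B)"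
    then have ij: "i < n" "j < n" using B n by auto
    then show "A' $$ (i, j) = four_block_mat (rdiag 1 1 (\<lambda>_. r)) (0\<^sub>m 1 m) (0\<^sub>m m 1) B $$ (i, j)"
      using A'0[of i] A'0'[of j] n by (cases i; cases j) (auto simp: B_def)
  qed (use A' B n in auto)
  have Bherm: "mat_adjoint B = B"
  proof (rule eq_matI)
    fix i j assume "i < dim_row B" "j < dim_col B"
    then have ij: "i < m" "j < m" using B by auto
    then show "mat_adjoint B $$ (i, j) = B $$ (i, j)"
      using index_mat_adjoint[of "Suc i" A' "Suc j"] A' n by (simp add: B_def herm)
  qed (use B in auto)
  have "similar_mat A' A"
    by (rule similar_matI[of _ _ "mat_adjoint W" W n]) (use A A' W WW in \<open>auto simp: A'_def\<close>)
  then have "char_poly A = char_poly A'" by (rule char_poly_similar[symmetric])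
  also have "\<dots> = char_poly (rdiag 1 1 (\<lambda>_. r)) * char_poly B"
    unfolding A'B by (rule char_poly_four_block_zeros_col) (use B in auto)
  also have "char_poly (rdiag 1 1 (\<lambda>_. r)) = [:- ?e, 1:]"
    by (simp add: rdiag_def char_poly_defs det_def sign_def)
  finally have "char_poly B = (\<Prod>r\<leftarrow>rs. [:- complex_of_real r, 1:])"
    unfolding cp by (metis mult_cancel_left pCons_eq_0_iff zero_neq_one)
  from Cons.IH[OF B Bherm this] obtain Q where Q: "Q \<in> carrier_mat m m"
    "mat_adjoint Q * Q = 1\<^sub>m m" "mat_adjoint Q * B * Q = rdiag m m (\<lambda>i. rs ! i)" by blast
  let ?Z = "0\<^sub>m 1 m" and ?Z' = "0\<^sub>m m 1" and ?I = "1\<^sub>m 1"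
  define F where "F = four_block_mat ?I ?Z ?Z' Q"
  have F: "F \<in> carrier_mat n n" using Q n by (auto simp: F_def)
  have Fad: "mat_adjoint F = four_block_mat ?I ?Z ?Z' (mat_adjoint Q)"
    by (rule eq_matI) (use Q in \<open>auto simp: F_def\<close>)
  have FF: "mat_adjoint F * F = 1\<^sub>m n"
  proof -
    have "mat_adjoint F * F = four_block_mat ?I ?Z ?Z' (1\<^sub>m m)"
      unfolding Fad unfolding F_def using Q(1,2) by (simp add: block_diagonal_mult)
    also have "\<dots> = 1\<^sub>m n" by (rule eq_matI) (auto simp: n)
    finally show ?thesis .
  qed
  have FAF: "mat_adjoint F * A' * F = rdiag n n (\<lambda>i. (r # rs) ! i)"
  proof -
    have "mat_adjoint F * A' * F
        = four_block_mat (rdiag 1 1 (\<lambda>_. r)) ?Z ?Z' (mat_adjoint Q * B * Q)"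
      unfolding Fad A'B unfolding F_def using Q(1) B
      by (simp add: block_diagonal_mult mult_carrier_mat[of _ m m])
    also have "\<dots> = rdiag n n (\<lambda>i. (r # rs) ! i)"
      unfolding Q(3) by (rule eq_matI) (auto simp: n nth_Cons')
    finally show ?thesis .
  qed
  have "mat_adjoint (W * F) * (W * F) = 1\<^sub>m n"
    using W(1) F FF by (simp add: mat_adjoint_mult mat_assoc mat_cancel[OF W(2)])
  moreover have "mat_adjoint (W * F) * A * (W * F) = rdiag n n (\<lambda>i. (r # rs) ! i)"
    using W F A FAF by (simp add: mat_adjoint_mult mat_assoc A'_def)
  ultimately show ?case using W F by (intro bexI[of _ "W * F"]) auto
qed

text \<open>A decomposition \<open>B = Z Q\<^sup>*\<close> with \<open>Q\<close> unitary and the columns of \<open>Z\<close> orthogonal. It carries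
  the information of a singular value decomposition without a completion of the left singular
  vectors to an orthonormal basis.\<close>

theorem orthogonal_column_factorization:
  assumes B: "B \<in> carrier_mat p q"
  obtains Z Q s where "Z \<in> carrier_mat p q" "Q \<in> carrier_mat q q"
    "mat_adjoint Q * Q = 1\<^sub>m q" "Q * mat_adjoint Q = 1\<^sub>m q" "B = Z * mat_adjoint Q"
    "mat_adjoint Z * Z = rdiag q q (\<lambda>i. (s i)\<^sup>2)"
    "\<And>i. i < q \<Longrightarrow> 0 \<le> s i" "\<And>i j. i \<le> j \<Longrightarrow> j < q \<Longrightarrow> s j \<le> s i"
    "singular_values B = take (min p q) (map s [0..<q])"
proof -
  let ?G = "mat_adjoint B * B"
  have G: "?G \<in> carrier_mat q q" "mat_adjoint ?G = ?G"
    using B by (auto intro!: carrier_matI simp: mat_adjoint_mult)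
  obtain as where as: "char_poly ?G = (\<Prod>a\<leftarrow>as. [:- a, 1:])" "length as = q"
    using char_poly_factorized[OF G(1)] by blast
  have real: "complex_of_real ((sqrt (Re a))\<^sup>2) = a \<and> 0 \<le> Re a" if a: "a \<in> set as" for a
  proof -
    have "poly (char_poly ?G) a = 0" unfolding as(1) using a by (auto simp: poly_prod_list prod_list_zero_iff)
    then have "eigenvalue ?G a" using eigenvalue_root_char_poly[OF G(1)] by simp
    then obtain v where v: "v \<in> carrier_vec q" "v \<noteq> 0\<^sub>v q" "?G *\<^sub>v v = a \<cdot>\<^sub>v v"
      using G by (auto simp: eigenvalue_def eigenvector_def)
    have "(B *\<^sub>v v) \<bullet>c (B *\<^sub>v v) = v \<bullet>c (?G *\<^sub>v v)"
      using B v(1) by (simp add: mat_adjoint_cinner mat_assoc_vec)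
    also have "\<dots> = cnj a * (v \<bullet>c v)" using v(1) unfolding v(3) by (simp add: conjugate_smult_vec)
    finally have eq: "complex_of_real ((vnorm (B *\<^sub>v v))\<^sup>2) = cnj a * complex_of_real ((vnorm v)\<^sup>2)"
      unfolding cinner_self .
    have nz: "(vnorm v)\<^sup>2 \<noteq> 0" using v by (auto simp: vnorm_eq_0)
    have "cnj a = complex_of_real ((vnorm (B *\<^sub>v v))\<^sup>2 / (vnorm v)\<^sup>2)"
      using eq nz by (simp add: field_simps)
    then have "a = complex_of_real ((vnorm (B *\<^sub>v v))\<^sup>2 / (vnorm v)\<^sup>2)"
      by (metis complex_cnj_cnj complex_cnj_complex_of_real)
    then show ?thesis by (simp del: of_real_divide of_real_power)
  qed
  define sv where "sv = rev (sorted_list_of_multiset (image_mset (\<lambda>z. sqrt (Re z)) (mset as)))"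
  have mset_sv: "mset sv = image_mset (\<lambda>z. sqrt (Re z)) (mset as)" by (simp add: sv_def)
  then have len: "length sv = q" using as(2) by (metis size_image_mset size_mset)
  have "mset (map (\<lambda>r. complex_of_real (r\<^sup>2)) sv) = image_mset (\<lambda>a. complex_of_real ((sqrt (Re a))\<^sup>2)) (mset as)"
    using mset_sv by (simp add: image_mset.compositionality o_def)
  also have "\<dots> = image_mset (\<lambda>a. a) (mset as)" by (rule image_mset_cong, rule real[THEN conjunct1], simp)
  finally have ms: "mset (map (\<lambda>r. complex_of_real (r\<^sup>2)) sv) = mset as" by simp
  have pl: "(\<Prod>a\<leftarrow>xs. [:- a, 1:]) = prod_mset (image_mset (\<lambda>a. [:- a, 1:]) (mset xs))"
    for xs :: "complex list"
    by (metis mset_map prod_mset_prod_list)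
  have "char_poly ?G = (\<Prod>a\<leftarrow>map (\<lambda>r. complex_of_real (r\<^sup>2)) sv. [:- a, 1:])"
    unfolding as(1) pl ms ..
  then have "char_poly ?G = (\<Prod>r\<leftarrow>map (\<lambda>r. r\<^sup>2) sv. [:- complex_of_real r, 1:])"
    by (simp add: o_def)
  from hermitian_diagonalization[OF G this] obtain Q where Q: "Q \<in> carrier_mat q q"
    "mat_adjoint Q * Q = 1\<^sub>m q" "mat_adjoint Q * ?G * Q = rdiag q q (\<lambda>i. map (\<lambda>r. r\<^sup>2) sv ! i)" by blast
  have QQ: "Q * mat_adjoint Q = 1\<^sub>m q"
    using mat_mult_left_right_inverse[of "mat_adjoint Q" q Q] Q by simp
  define s where "s i = sv ! i" for i
  have sv: "sv = map s [0..<q]" using len by (auto simp: s_def intro: nth_equalityI)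
  have "mat_adjoint (B * Q) * (B * Q) = rdiag q q (\<lambda>i. map (\<lambda>r. r\<^sup>2) sv ! i)"
    using B Q by (simp add: mat_adjoint_mult mat_assoc)
  also have "\<dots> = rdiag q q (\<lambda>i. (s i)\<^sup>2)" by (rule rdiag_cong) (use len in \<open>auto simp: s_def\<close>)
  finally have ZZ: "mat_adjoint (B * Q) * (B * Q) = rdiag q q (\<lambda>i. (s i)\<^sup>2)" .
  have BZ: "B = B * Q * mat_adjoint Q" using B Q QQ by (simp add: mat_assoc)
  have nonneg: "0 \<le> s i" if "i < q" for i
  proof -
    have "sv ! i \<in># mset sv" using that len by auto
    then show ?thesis unfolding mset_sv s_def using real by auto
  qed
  have desc: "s j \<le> s i" if "i \<le> j" "j < q" for i j
  proof -
    have "sorted_wrt (\<ge>) sv" unfolding sv_def by (simp add: sorted_wrt_rev)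
    then show ?thesis using that len by (cases "i = j") (auto simp: s_def sorted_wrt_iff_nth_less)
  qed
  have roots: "proots (char_poly ?G) = mset as"
  proof -
    have "proots (\<Prod>a\<leftarrow>xs. [:- a, 1:]) = mset xs" for xs :: "complex list"
    proof (induction xs)
      case (Cons a xs)
      have "(\<Prod>a\<leftarrow>xs. [:- a, 1:]) \<noteq> 0" by (auto simp: prod_list_zero_iff)
      then have "proots ([:- a, 1:] * (\<Prod>a\<leftarrow>xs. [:- a, 1:])) = {#a#} + mset xs"
        by (subst proots_mult) (use Cons in auto)
      then show ?case by simp
    qed simp
    then show ?thesis unfolding as(1) .
  qed
  have "singular_values B = take (min p q) sv"
    unfolding singular_values_def roots sv_def using B by simp
  then show ?thesis
    using that[of "B * Q" Q s] B Q QQ ZZ BZ nonneg desc sv by auto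
qed

section \<open>Rank factorization\<close>

lemma wide_matrix_kernel:
  fixes N :: "complex mat"
  assumes N: "N \<in> carrier_mat i (Suc i)"
  obtains w where "w \<in> carrier_vec (Suc i)" "w \<noteq> 0\<^sub>v (Suc i)" "N *\<^sub>v w = 0\<^sub>v i"
proof -
  \<comment> \<open>Complete \<open>N\<close> by a zero row to a singular square matrix.\<close>
  define N' where "N' = mat (Suc i) (Suc i) (\<lambda>(a, b). if a < i then N $$ (a, b) else 0)"
  have N': "N' \<in> carrier_mat (Suc i) (Suc i)" by (simp add: N'_def)
  have "transpose_mat N' *\<^sub>v unit_vec (Suc i) i = 0\<^sub>v (Suc i)"
    by (rule eq_vecI) (use N' in \<open>auto simp: N'_def\<close>)
  then have "det (transpose_mat N') = 0"
    using det_0_iff_vec_prod_zero_field[of "transpose_mat N'" "Suc i"] N'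
      unit_vec_nonzero[of i "Suc i"] unit_vec_carrier[of "Suc i" i]
    by (metis lessI transpose_carrier_mat)
  then have "det N' = 0" using det_transpose[OF N'] by simp
  then obtain w where w: "w \<in> carrier_vec (Suc i)" "w \<noteq> 0\<^sub>v (Suc i)" "N' *\<^sub>v w = 0\<^sub>v (Suc i)"
    using det_0_iff_vec_prod_zero_field[OF N'] by blast
  have "N *\<^sub>v w = 0\<^sub>v i"
  proof (rule eq_vecI)
    fix a assume a: "a < dim_vec (0\<^sub>v i :: complex vec)"
    have "(N *\<^sub>v w) $ a = (N' *\<^sub>v w) $ a"
      using a w(1) N N' by (subst (1 2) mat_mult_vec_index) (auto simp: N'_def)
    then show "(N *\<^sub>v w) $ a = 0\<^sub>v i $ a" using a w(3) by simp
  qed (use N in auto)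
  then show ?thesis using that w by blast
qed

lemma mrank_mult_le:
  assumes L: "L \<in> carrier_mat p r" and M: "M \<in> carrier_mat r q"
  shows "mrank (L * M) \<le> r"
proof -
  interpret vec_space "TYPE(complex)" p .
  have LM: "L * M \<in> carrier_mat p q" using L M by simp
  have "set (cols (L * M)) \<subseteq> col_space L"
  proof
    fix x assume "x \<in> set (cols (L * M))"
    then obtain j where j: "j < q" "x = col (L * M) j"
      using LM by (auto simp: cols_def)
    then have "x = L *\<^sub>v col M j" using L M by (auto intro!: eq_vecI)
    then show "x \<in> col_space L" unfolding col_space_eq[OF L] using L M j by auto
  qed
  then have sub: "span (set (cols (L * M))) \<subseteq> span (set (cols L))"
    unfolding col_space_def
    by (metis L carrier_matD(1) cols_dim span_is_submodule span_is_subset)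
  have subsp: "VectorSpace.subspace class_ring (span (set (cols L))) V"
    "VectorSpace.subspace class_ring (span (set (cols (L * M)))) V"
    using L LM by (metis carrier_matD(1) cols_dim span_is_subspace)+
  have "rank (L * M) \<le> rank L"
    unfolding rank_def
    using vectorspace.subspace_dim[OF subspace_is_vs[OF subsp(1)] nested_subspaces[OF subsp sub]]
      fin_dim_span_cols[OF L] fin_dim_span_cols[OF LM] by auto
  also have "\<dots> \<le> r" by (rule rank_le_nc[OF L])
  finally show ?thesis using L by (simp add: mrank_def)
qed

lemma mrank_factorization:
  assumes B: "B \<in> carrier_mat p q" and r: "mrank B \<le> r"
  obtains L M where "L \<in> carrier_mat p r" "M \<in> carrier_mat r q" "B = L * M"
proof -
  interpret vec_space "TYPE(complex)" p .
  have cB: "set (cols B) \<subseteq> carrier_vec p" using cols_dim[of B] B by auto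
  have "lin_indpt {}" by (simp add: lin_dep_def)
  then obtain S where S: "finite S" "maximal S (\<lambda>T. T \<subseteq> set (cols B) \<and> lin_indpt T)"
    using maximal_exists_superset[of "set (cols B)" "\<lambda>T. T \<subseteq> set (cols B) \<and> lin_indpt T" "{}"]
    by auto
  have SB: "S \<subseteq> set (cols B)" "lin_indpt S" using S(2) by (auto simp: maximal_def)
  have card: "card S \<le> r" using rank_card_indpt[OF B S(2)] r B by (simp add: mrank_def)
  obtain ss where ss: "set ss = S" "distinct ss" using S(1) finite_distinct_list by blast
  have len: "length ss \<le> r" using card ss distinct_card by fastforce
  define L0 where "L0 = mat_of_cols p ss"
  have L0: "L0 \<in> carrier_mat p (length ss)" by (simp add: L0_def)
  have colsL0: "cols L0 = ss" unfolding L0_def using ss SB cB by (intro cols_mat_of_cols) auto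
  have "\<exists>x \<in> carrier_vec (length ss). L0 *\<^sub>v x = col B j" if j: "j < q" for j
  proof -
    have c: "col B j \<in> set (cols B)" using j B by (auto simp: cols_def)
    have "col B j \<in> span S"
    proof (cases "col B j \<in> S")
      case True then show ?thesis using SB cB by (meson in_own_span subset_trans subsetD)
    next
      case False
      have "lin_dep (S \<union> {col B j})"
      proof (rule ccontr)
        assume "lin_indpt (S \<union> {col B j})"
        then have "S \<union> {col B j} = S" using S(2) SB c unfolding maximal_def by blast
        then show False using False by blast
      qed
      then show ?thesis
        using lin_dep_iff_in_span[of S "col B j"] False SB cB c by blast
    qed
    then have "col B j \<in> col_space L0" unfolding col_space_def colsL0 ss .
    then show ?thesis unfolding col_space_eq[OF L0] using L0 by auto
  qed
  then obtain x where x: "\<And>j. j < q \<Longrightarrow> x j \<in> carrier_vec (length ss) \<and> L0 *\<^sub>v x j = col B j"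
    by metis
  \<comment> \<open>Zero columns and rows fill the inner dimension up to \<open>r\<close>.\<close>
  define L where "L = mat p r (\<lambda>(a, b). if b < length ss then L0 $$ (a, b) else 0)"
  define M where "M = mat r q (\<lambda>(a, b). if a < length ss then x b $ a else 0)"
  have "B = L * M"
  proof (rule eq_matI)
    fix a b assume "a < dim_row (L * M)" "b < dim_col (L * M)"
    then have ab: "a < p" "b < q" by (auto simp: L_def M_def)
    have xb: "dim_vec (x b) = length ss" using x[OF ab(2)] by auto
    have "(L * M) $$ (a, b) = (\<Sum>l<r. L $$ (a, l) * M $$ (l, b))"
      using ab by (subst mat_mult_index) (auto simp: L_def M_def)
    also have "\<dots> = (\<Sum>l<length ss. L0 $$ (a, l) * x b $ l)"
      by (rule sum.mono_neutral_cong_right) (use ab len in \<open>auto simp: L_def M_def\<close>)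
    also have "\<dots> = (L0 *\<^sub>v x b) $ a"
      using xb L0 ab by (subst mat_mult_vec_index) auto
    also have "\<dots> = B $$ (a, b)" using x[OF ab(2)] B ab by auto
    finally show "B $$ (a, b) = (L * M) $$ (a, b)" by simp
  qed (use B in \<open>auto simp: L_def M_def\<close>)
  then show ?thesis using that[of L M] by (simp add: L_def M_def)
qed

section \<open>Singular values as approximation numbers\<close>

text \<open>Numbering from 0 makes the index the rank of the approximating matrices below; continuation by
  zeros makes matrices of different sizes comparable.\<close>

definition sigma :: "complex mat \<Rightarrow> nat \<Rightarrow> real" where
  "sigma B i = (if i < length (singular_values B) then singular_values B ! i else 0)"

definition approximable :: "complex mat \<Rightarrow> nat \<Rightarrow> real \<Rightarrow> bool" where
  "approximable B i c \<longleftrightarrow>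
     (\<exists>L \<in> carrier_mat (dim_row B) i. \<exists>M \<in> carrier_mat i (dim_col B). op_bound (B - L * M) c)"

lemma approximableI:
  assumes "L \<in> carrier_mat (dim_row B) i" "M \<in> carrier_mat i (dim_col B)" "op_bound (B - L * M) c"
  shows "approximable B i c"
  using assms by (auto simp: approximable_def)

lemma vnorm_orthogonal_columns:
  assumes Z: "Z \<in> carrier_mat p q" "mat_adjoint Z * Z = rdiag q q (\<lambda>i. (s i)\<^sup>2)"
    and z: "dim_vec z = q"
  shows "(vnorm (Z *\<^sub>v z))\<^sup>2 = (\<Sum>i<q. (s i)\<^sup>2 * (cmod (z $ i))\<^sup>2)"
proof -
  have "complex_of_real ((vnorm (Z *\<^sub>v z))\<^sup>2) = z \<bullet>c (mat_adjoint Z * Z *\<^sub>v z)"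
    unfolding cinner_self[symmetric] using Z(1) z
    by (simp add: mat_adjoint_cinner mat_assoc_vec)
  also have "\<dots> = (\<Sum>i<q. z $ i * cnj (complex_of_real ((s i)\<^sup>2) * z $ i))"
    unfolding Z(2) rdiag_mult_vec[OF z] using z
    by (auto simp: scalar_prod_def atLeast0LessThan intro!: sum.cong)
  also have "\<dots> = complex_of_real (\<Sum>i<q. (s i)\<^sup>2 * (cmod (z $ i))\<^sup>2)"
    unfolding of_real_sum
  proof (rule sum.cong)
    fix i assume "i \<in> {..<q}"
    show "z $ i * cnj (complex_of_real ((s i)\<^sup>2) * z $ i)
        = complex_of_real ((s i)\<^sup>2 * (cmod (z $ i))\<^sup>2)"
      by (simp only: of_real_mult complex_norm_square complex_cnj_mult complex_cnj_complex_of_real mult_ac)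
  qed simp
  finally show ?thesis using of_real_eq_iff by blast
qed

text \<open>If the norms of the columns of \<open>Z\<close> decrease, \<open>Z Q\<^sup>*\<close> is approximated by keeping the first
  columns; no other matrix of that rank does better, because its kernel contains a vector in the span
  of one column of \<open>Q\<close> more, on which \<open>Z Q\<^sup>*\<close> is large.\<close>

lemma approximable_orthogonal_columns:
  assumes Z: "Z \<in> carrier_mat p q" "mat_adjoint Z * Z = rdiag q q (\<lambda>i. (s i)\<^sup>2)"
    and Q: "Q \<in> carrier_mat q q" "mat_adjoint Q * Q = 1\<^sub>m q" "Q * mat_adjoint Q = 1\<^sub>m q"
    and s: "\<And>i. i < q \<Longrightarrow> 0 \<le> s i" "\<And>i j. i \<le> j \<Longrightarrow> j < q \<Longrightarrow> s j \<le> s i"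
    and c: "0 \<le> c"
  shows "approximable (Z * mat_adjoint Q) i c \<longleftrightarrow> (i < q \<longrightarrow> s i \<le> c)"
proof
  assume le: "i < q \<longrightarrow> s i \<le> c"
  define K where "K = rdiag q i (\<lambda>_. 1)"
  define T where "T = rdiag q q (\<lambda>j. if j < i then 0 else 1)"
  have KT: "K * mat_adjoint K = 1\<^sub>m q - T"
    unfolding K_def T_def rdiag_adjoint rdiag_mult by (rule eq_matI) auto
  have [simp]: "dim_row K = q" "dim_col K = i" "dim_row T = q" "dim_col T = q"
    by (auto simp: K_def T_def)
  have "Z * mat_adjoint Q - Z * K * (mat_adjoint K * mat_adjoint Q) = Z * T * mat_adjoint Q"
  proof -
    have "Z * K * (mat_adjoint K * mat_adjoint Q) = Z * (K * mat_adjoint K) * mat_adjoint Q"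
      using Z(1) Q(1) by (simp add: mat_assoc)
    also have "\<dots> = Z * mat_adjoint Q - Z * T * mat_adjoint Q"
      unfolding KT using Z(1) Q(1) by (simp add: mat_distribs)
    finally show ?thesis using Z(1) Q(1) by (auto intro!: eq_matI)
  qed
  moreover have "op_bound (Z * T) c"
    unfolding op_bound_def
  proof (intro conjI ballI)
    fix x :: "complex vec" assume "x \<in> carrier_vec (dim_col (Z * T))"
    then have x: "dim_vec x = q" by auto
    have Tx: "T *\<^sub>v x = vec q (\<lambda>j. if j < i then 0 else x $ j)"
      unfolding T_def rdiag_mult_vec[OF x] by (rule eq_vecI) auto
    have "(vnorm (Z * T *\<^sub>v x))\<^sup>2 = (\<Sum>j<q. (s j)\<^sup>2 * (cmod ((T *\<^sub>v x) $ j))\<^sup>2)"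
      using Z x vnorm_orthogonal_columns[OF Z, of "T *\<^sub>v x"] by (simp add: mat_assoc_vec)
    also have "\<dots> \<le> (\<Sum>j<q. c\<^sup>2 * (cmod (x $ j))\<^sup>2)"
    proof (rule sum_mono)
      fix j assume j: "j \<in> {..<q}"
      show "(s j)\<^sup>2 * (cmod ((T *\<^sub>v x) $ j))\<^sup>2 \<le> c\<^sup>2 * (cmod (x $ j))\<^sup>2"
      proof (cases "j < i")
        case False
        then have "s j \<le> c" using le j s(2)[of i j] by force
        then have "(s j)\<^sup>2 \<le> c\<^sup>2" using s(1) j by (intro power_mono) auto
        then show ?thesis using False j by (simp add: Tx mult_right_mono)
      qed (use j in \<open>simp add: Tx\<close>)
    qed
    also have "\<dots> = (c * vnorm x)\<^sup>2"
      by (simp add: power_mult_distrib vnorm_sq x sum_distrib_left)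
    finally show "vnorm (Z * T *\<^sub>v x) \<le> c * vnorm x"
      by (rule power2_le_imp_le) (use c in simp)
  qed (rule c)
  then have "op_bound (Z * T * mat_adjoint Q) (c * 1)"
    by (rule op_bound_mult) (use Q in \<open>auto intro!: op_bound_adjoint op_bound_isometry\<close>)
  ultimately show "approximable (Z * mat_adjoint Q) i c"
    by (intro approximableI[of "Z * K" _ _ "mat_adjoint K * mat_adjoint Q"])
      (use Z(1) Q(1) in \<open>auto intro!: carrier_matI\<close>)
next
  assume "approximable (Z * mat_adjoint Q) i c"
  then obtain L M where LM: "L \<in> carrier_mat p i" "M \<in> carrier_mat i q"
    "op_bound (Z * mat_adjoint Q - L * M) c"
    using Z(1) Q(1) by (auto simp: approximable_def)
  show "i < q \<longrightarrow> s i \<le> c"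
  proof
    assume i: "i < q"
    define K where "K = rdiag q (Suc i) (\<lambda>_. 1)"
    have [simp]: "dim_row K = q" "dim_col K = Suc i" by (auto simp: K_def)
    have "M * Q * K \<in> carrier_mat i (Suc i)" using LM Q by (auto intro!: carrier_matI)
    then obtain w where w: "w \<in> carrier_vec (Suc i)" "w \<noteq> 0\<^sub>v (Suc i)" "M * Q * K *\<^sub>v w = 0\<^sub>v i"
      by (rule wide_matrix_kernel)
    define z where "z = K *\<^sub>v w"
    have z: "dim_vec z = q" "z = vec q (\<lambda>j. if j < Suc i then w $ j else 0)"
      unfolding z_def K_def using w(1) by (auto simp: rdiag_mult_vec)
    have vz: "(vnorm w)\<^sup>2 = (\<Sum>j<Suc i. (cmod (z $ j))\<^sup>2)"
      unfolding vnorm_sq using w(1) i by (auto simp: z(2) intro!: sum.cong)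
    have vz': "(vnorm z)\<^sup>2 = (vnorm w)\<^sup>2"
      unfolding vz unfolding vnorm_sq z(1)
      by (rule sum.mono_neutral_cong_right) (use i in \<open>auto simp: z(2)\<close>)
    have "M *\<^sub>v (Q *\<^sub>v z) = 0\<^sub>v i"
      using w LM(2) Q(1) by (simp add: z_def mat_assoc_vec)
    then have "(Z * mat_adjoint Q - L * M) *\<^sub>v (Q *\<^sub>v z) = Z *\<^sub>v z"
      using Z(1) Q(1) LM z(1)
      by (simp add: mat_distribs_vec mat_assoc_vec mat_cancel_vec[OF Q(2)]) (auto intro!: eq_vecI)
    then have "vnorm (Z *\<^sub>v z) \<le> c * vnorm (Q *\<^sub>v z)"
      using op_boundD[OF LM(3), of "Q *\<^sub>v z"] LM(2) Q(1) by simp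
    also have "vnorm (Q *\<^sub>v z) = vnorm z" by (rule vnorm_isometry) (use Q z in auto)
    finally have "(vnorm (Z *\<^sub>v z))\<^sup>2 \<le> (c * vnorm z)\<^sup>2" by (rule power_mono) simp
    moreover have "(s i)\<^sup>2 * (vnorm w)\<^sup>2 \<le> (vnorm (Z *\<^sub>v z))\<^sup>2"
    proof -
      have "(s i)\<^sup>2 * (vnorm w)\<^sup>2 \<le> (\<Sum>j<Suc i. (s j)\<^sup>2 * (cmod (z $ j))\<^sup>2)"
        unfolding vz sum_distrib_left
        using i s by (intro sum_mono mult_right_mono power_mono) auto
      also have "\<dots> \<le> (\<Sum>j<q. (s j)\<^sup>2 * (cmod (z $ j))\<^sup>2)"
        by (rule sum_mono2) (use i in auto)
      finally show ?thesis using vnorm_orthogonal_columns[OF Z z(1)] by simp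
    qed
    ultimately have "(s i)\<^sup>2 * (vnorm w)\<^sup>2 \<le> c\<^sup>2 * (vnorm w)\<^sup>2"
      by (simp add: power_mult_distrib vz')
    moreover have "0 < (vnorm w)\<^sup>2" using w by (auto simp: vnorm_eq_0)
    ultimately have "(s i)\<^sup>2 \<le> c\<^sup>2" by (simp only: mult_le_cancel_right_pos)
    then show "s i \<le> c" by (rule power2_le_imp_le) (rule c)
  qed
qed

lemma op_bound_zero: "op_bound (0\<^sub>m p q) 0"
proof -
  have "0\<^sub>m p q *\<^sub>v x = 0\<^sub>v p" if "dim_vec x = q" for x :: "complex vec"
    by (rule eq_vecI) (use that in \<open>auto simp: scalar_prod_def\<close>)
  then show ?thesis by (auto simp: op_bound_def)
qed

text \<open>There are \<open>q\<close> square roots of eigenvalues but only \<open>min p q\<close> singular values; the remaining ones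
  vanish since \<open>B\<close> approximates itself with rank \<open>p\<close>.\<close>

lemma sigma_orthogonal_columns:
  assumes B: "B \<in> carrier_mat p q"
  obtains Z Q where "Z \<in> carrier_mat p q" "Q \<in> carrier_mat q q"
    "mat_adjoint Q * Q = 1\<^sub>m q" "Q * mat_adjoint Q = 1\<^sub>m q" "B = Z * mat_adjoint Q"
    "mat_adjoint Z * Z = rdiag q q (\<lambda>i. (sigma B i)\<^sup>2)"
    "length (singular_values B) = min p q"
    "\<And>i. 0 \<le> sigma B i" "\<And>i j. i \<le> j \<Longrightarrow> sigma B j \<le> sigma B i"
    "\<And>i. min p q \<le> i \<Longrightarrow> sigma B i = 0"
proof -
  from orthogonal_column_factorization[OF B] obtain Z Q s where d: "Z \<in> carrier_mat p q" "Q \<in> carrier_mat q q"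
    "mat_adjoint Q * Q = 1\<^sub>m q" "Q * mat_adjoint Q = 1\<^sub>m q" "B = Z * mat_adjoint Q"
    "mat_adjoint Z * Z = rdiag q q (\<lambda>i. (s i)\<^sup>2)"
    "\<And>i. i < q \<Longrightarrow> 0 \<le> s i" "\<And>i j. i \<le> j \<Longrightarrow> j < q \<Longrightarrow> s j \<le> s i"
    "singular_values B = take (min p q) (map s [0..<q])" by metis
  have len: "length (singular_values B) = min p q" by (simp add: d(9))
  have sig: "sigma B i = (if i < min p q then s i else 0)" for i
    by (simp add: sigma_def d(9))
  have zero: "s i = 0" if i: "p \<le> i" "i < q" for i
  proof -
    have "op_bound (B - 1\<^sub>m p * B) 0"
      using B op_bound_zero[of p q] by simp
    then have "approximable B p 0"
      by (intro approximableI[of "1\<^sub>m p" _ _ B]) (use B in auto)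
    then have "s p \<le> 0"
      unfolding d(5) using approximable_orthogonal_columns[OF d(1,6,2,3,4,7,8)] i by auto
    then show ?thesis using d(7)[of i] d(8)[of p i] i by auto
  qed
  have sig': "sigma B i = s i" if "i < q" for i using that zero[of i] by (auto simp: sig)
  have "rdiag q q (\<lambda>i. (s i)\<^sup>2) = rdiag q q (\<lambda>i. (sigma B i)\<^sup>2)"
    by (rule rdiag_cong) (simp add: sig')
  moreover have "0 \<le> sigma B i" for i using d(7) by (auto simp: sig)
  moreover have "sigma B j \<le> sigma B i" if "i \<le> j" for i j
    using that d(7)[of i] d(8)[of i j] by (auto simp: sig)
  moreover have "sigma B i = 0" if "min p q \<le> i" for i using that by (auto simp: sig)
  ultimately show ?thesis using that[of Z Q] d(1-6) len by auto
qed

lemma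
  shows length_singular_values: "length (singular_values B) = min (dim_row B) (dim_col B)"
    and sigma_nonneg [simp]: "0 \<le> sigma B i"
    and sigma_antimono: "i \<le> j \<Longrightarrow> sigma B j \<le> sigma B i"
proof -
  have "length (singular_values B) = min (dim_row B) (dim_col B) \<and> 0 \<le> sigma B i
      \<and> (i \<le> j \<longrightarrow> sigma B j \<le> sigma B i)"
  proof (rule sigma_orthogonal_columns[OF carrier_matI[OF refl refl], of B])
    assume "length (singular_values B) = min (dim_row B) (dim_col B)"
      "\<And>i. 0 \<le> sigma B i" "\<And>i j. i \<le> j \<Longrightarrow> sigma B j \<le> sigma B i"
    then show ?thesis by blast
  qed
  then show "length (singular_values B) = min (dim_row B) (dim_col B)" "0 \<le> sigma B i"
    "i \<le> j \<Longrightarrow> sigma B j \<le> sigma B i" by auto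
qed

lemma sigma_sing_val: "i < min (dim_row B) (dim_col B) \<Longrightarrow> sing_val B (Suc i) = sigma B i"
  by (simp add: sing_val_def sigma_def length_singular_values)

text \<open>The Eckart-Young theorem for the spectral norm. Low rank is expressed by a factorization, which
  is how multiplication and addition act on it, so inequalities for products and sums follow.\<close>

theorem sigma_le_iff: "0 \<le> c \<Longrightarrow> sigma B i \<le> c \<longleftrightarrow> approximable B i c"
proof -
  assume c: "0 \<le> c"
  show ?thesis
  proof (rule sigma_orthogonal_columns[OF carrier_matI[OF refl refl], of B])
    fix Z Q
    assume d: "Z \<in> carrier_mat (dim_row B) (dim_col B)" "Q \<in> carrier_mat (dim_col B) (dim_col B)"
      "mat_adjoint Q * Q = 1\<^sub>m (dim_col B)" "Q * mat_adjoint Q = 1\<^sub>m (dim_col B)"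
      "B = Z * mat_adjoint Q"
      "mat_adjoint Z * Z = rdiag (dim_col B) (dim_col B) (\<lambda>i. (sigma B i)\<^sup>2)"
      "\<And>i. 0 \<le> sigma B i" "\<And>i j. i \<le> j \<Longrightarrow> sigma B j \<le> sigma B i"
      "\<And>i. min (dim_row B) (dim_col B) \<le> i \<Longrightarrow> sigma B i = 0"
    have "approximable B i c \<longleftrightarrow> (i < dim_col B \<longrightarrow> sigma B i \<le> c)"
      using approximable_orthogonal_columns[OF d(1,6,2,3,4) d(7,8) c, of i] d(5) by simp
    then show ?thesis using d(9)[of i] c by (cases "i < dim_col B") auto
  qed
qed

lemma approximable_sigma: "approximable B i (sigma B i)"
  using sigma_le_iff[of "sigma B i" B i] by simp

lemma sigma_0_op_bound: "op_bound B (sigma B 0)"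
proof -
  obtain L M where LM: "L \<in> carrier_mat (dim_row B) 0" "M \<in> carrier_mat 0 (dim_col B)"
    "op_bound (B - L * M) (sigma B 0)"
    using approximable_sigma[of B 0] by (auto simp: approximable_def)
  have "B - L * M = B" by (rule eq_matI) (use LM in \<open>auto simp: scalar_prod_def\<close>)
  then show ?thesis using LM by simp
qed

lemma sigma_mult_le:
  assumes X: "op_bound X x" and Y: "op_bound Y y"
    and d: "dim_col X = dim_row B" "dim_col B = dim_row Y"
  shows "sigma (X * B * Y) i \<le> x * y * sigma B i"
proof -
  obtain L M where LM: "L \<in> carrier_mat (dim_row B) i" "M \<in> carrier_mat i (dim_col B)"
    "op_bound (B - L * M) (sigma B i)"
    using approximable_sigma[of B i] by (auto simp: approximable_def)
  have xy: "0 \<le> x" "0 \<le> y" using X Y by (auto simp: op_bound_def)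
  have "X * B * Y - X * L * (M * Y) = X * (B - L * M) * Y"
    using LM d by (simp add: mat_distribs mat_assoc)
  moreover have "op_bound (X * (B - L * M) * Y) (x * sigma B i * y)"
    using LM d X Y by (intro op_bound_mult) auto
  ultimately have "approximable (X * B * Y) i (x * sigma B i * y)"
    by (intro approximableI[of "X * L" _ _ "M * Y"]) (use LM d in \<open>auto intro!: carrier_matI\<close>)
  then show ?thesis using sigma_le_iff[of "x * sigma B i * y" "X * B * Y" i] xy by (simp add: mult_ac)
qed

lemma sigma_add_le:
  assumes D: "op_bound D d" and dims: "dim_row B = dim_row D" "dim_col B = dim_col D"
  shows "sigma (B + D) i \<le> sigma B i + d"
proof -
  obtain L M where LM: "L \<in> carrier_mat (dim_row B) i" "M \<in> carrier_mat i (dim_col B)"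
    "op_bound (B - L * M) (sigma B i)"
    using approximable_sigma[of B i] by (auto simp: approximable_def)
  have "B + D - L * M = (B - L * M) + D" by (rule eq_matI) (use LM dims in auto)
  moreover have "op_bound ((B - L * M) + D) (sigma B i + d)"
    using LM D dims by (intro op_bound_add) auto
  ultimately have "approximable (B + D) i (sigma B i + d)"
    by (intro approximableI[of L _ _ M]) (use LM dims in auto)
  then show ?thesis
    using sigma_le_iff[of "sigma B i + d" "B + D" i] D by (simp add: op_bound_def)
qed

text \<open>A matrix of rank \<open>r\<close> can be absorbed into the approximating matrices.\<close>

lemma sigma_low_rank_le:
  assumes F: "L0 \<in> carrier_mat (dim_row B) r" "M0 \<in> carrier_mat r (dim_col B)"
  shows "sigma B (i + r) \<le> sigma (B - L0 * M0) i"
proof -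
  let ?D = "B - L0 * M0"
  obtain L M where LM: "L \<in> carrier_mat (dim_row B) i" "M \<in> carrier_mat i (dim_col B)"
    "op_bound (?D - L * M) (sigma ?D i)"
    using approximable_sigma[of ?D i] F by (auto simp: approximable_def)
  define L' where "L' = mat (dim_row B) (i + r) (\<lambda>(a, b). if b < i then L $$ (a, b) else L0 $$ (a, b - i))"
  define M' where "M' = mat (i + r) (dim_col B) (\<lambda>(a, b). if a < i then M $$ (a, b) else M0 $$ (a - i, b))"
  have "B - L' * M' = ?D - L * M"
  proof (rule eq_matI)
    fix a b assume "a < dim_row (?D - L * M)" "b < dim_col (?D - L * M)"
    then have ab: "a < dim_row B" "b < dim_col B" using LM F by auto
    have "(L' * M') $$ (a, b) = (\<Sum>l<i + r. L' $$ (a, l) * M' $$ (l, b))"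
      using ab by (subst mat_mult_index) (auto simp: L'_def M'_def)
    also have "\<dots> = (\<Sum>l<i. L' $$ (a, l) * M' $$ (l, b)) + (\<Sum>l<r. L' $$ (a, i + l) * M' $$ (i + l, b))"
      unfolding lessThan_atLeast0
      by (subst sum.atLeastLessThan_concat[of 0 i "i + r", symmetric])
        (auto simp: sum.shift_bounds_nat_ivl[of _ 0 i r, simplified add.commute, simplified] add.commute)
    also have "(\<Sum>l<i. L' $$ (a, l) * M' $$ (l, b)) = (L * M) $$ (a, b)"
      using ab LM by (subst mat_mult_index) (auto simp: L'_def M'_def)
    also have "(\<Sum>l<r. L' $$ (a, i + l) * M' $$ (i + l, b)) = (L0 * M0) $$ (a, b)"
      using ab F by (subst mat_mult_index) (auto simp: L'_def M'_def)
    finally show "(B - L' * M') $$ (a, b) = (?D - L * M) $$ (a, b)"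
      using ab LM F by (simp add: L'_def M'_def del: index_mult_mat(1))
  qed (use LM F in \<open>auto simp: L'_def M'_def\<close>)
  then have "approximable B (i + r) (sigma ?D i)"
    by (intro approximableI[of L' _ _ M']) (use LM in \<open>auto simp: L'_def M'_def\<close>)
  then show ?thesis using sigma_le_iff[of "sigma ?D i" B "i + r"] by simp
qed

lemma mrank_le_iff_sigma: "mrank B \<le> r \<longleftrightarrow> sigma B r = 0"
proof
  assume "mrank B \<le> r"
  then obtain L M where LM: "L \<in> carrier_mat (dim_row B) r" "M \<in> carrier_mat r (dim_col B)" "B = L * M"
    by (rule mrank_factorization[OF carrier_matI[OF refl refl]])
  have "op_bound (B - L * M) 0"
    unfolding LM(3)[symmetric] minus_r_inv_mat[OF carrier_matI[OF refl refl]] by (rule op_bound_zero)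
  with LM(1,2) have "approximable B r 0" by (rule approximableI)
  then show "sigma B r = 0" using sigma_le_iff[of 0 B r] sigma_nonneg[of B r] by linarith
next
  assume "sigma B r = 0"
  then obtain L M where LM: "L \<in> carrier_mat (dim_row B) r" "M \<in> carrier_mat r (dim_col B)"
    "op_bound (B - L * M) 0"
    using approximable_sigma[of B r] by (auto simp: approximable_def)
  have "B = L * M"
  proof (rule eq_matI)
    fix a b assume "a < dim_row (L * M)" "b < dim_col (L * M)"
    then have ab: "a < dim_row B" "b < dim_col B" using LM by auto
    have "vnorm ((B - L * M) *\<^sub>v unit_vec (dim_col B) b) = 0"
      using op_boundD[OF LM(3), of "unit_vec (dim_col B) b"] LM(2)
        vnorm_nonneg[of "(B - L * M) *\<^sub>v unit_vec (dim_col B) b"] by simp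
    then have "((B - L * M) *\<^sub>v unit_vec (dim_col B) b) $ a = 0"
      unfolding vnorm_eq_0 using ab LM by (metis dim_mult_mat_vec index_minus_mat(2) index_mult_mat(2) carrier_matD(1) index_zero_vec(1))
    moreover have "((B - L * M) *\<^sub>v unit_vec (dim_col B) b) $ a = (B - L * M) $$ (a, b)"
      using ab LM by (simp add: row_def)
    ultimately show "B $$ (a, b) = (L * M) $$ (a, b)" using ab LM by simp
  qed (use LM in auto)
  then show "mrank B \<le> r" using mrank_mult_le[OF LM(1,2)] by simp
qed

lemma take_mrank_singular_values:
  "take (mrank B) (singular_values B) = map (sigma B) [0..<mrank B]"
proof -
  have "sigma B (min (dim_row B) (dim_col B)) = 0" by (simp add: sigma_def length_singular_values)
  then have "mrank B \<le> length (singular_values B)"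
    unfolding mrank_le_iff_sigma length_singular_values .
  then show ?thesis by (auto intro!: nth_equalityI simp: sigma_def)
qed

lemma mrank_cong_sigma: "sigma B = sigma D \<Longrightarrow> mrank B = mrank D"
  by (metis mrank_le_iff_sigma dual_order.refl le_antisym)

lemma sigma_rdiag:
  assumes s: "\<And>i. i < N \<Longrightarrow> 0 \<le> s i" "\<And>i j. i \<le> j \<Longrightarrow> j < N \<Longrightarrow> s j \<le> s i"
  shows "sigma (rdiag N N s) i = (if i < N then s i else 0)"
proof -
  have "approximable (rdiag N N s * mat_adjoint (1\<^sub>m N)) i c \<longleftrightarrow> (i < N \<longrightarrow> s i \<le> c)" if "0 \<le> c" for c
    by (rule approximable_orthogonal_columns)
      (use s that in \<open>auto simp: rdiag_mult power2_eq_square intro!: rdiag_cong\<close>)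
  then have *: "sigma (rdiag N N s) i \<le> c \<longleftrightarrow> (i < N \<longrightarrow> s i \<le> c)" if "0 \<le> c" for c
    using that sigma_le_iff by simp
  show ?thesis
    using *[of "s i"] *[of "sigma (rdiag N N s) i"] *[of 0] s(1)[of i] sigma_nonneg[of "rdiag N N s" i]
    by (cases "i < N") auto
qed

section \<open>Unitarily invariant norms\<close>

lemma mats_iff: "B \<in> mats K p q \<longleftrightarrow> B \<in> carrier_mat p q \<and> (\<forall>i<p. \<forall>j<q. B $$ (i, j) \<in> K)"
  unfolding mats_def by (fastforce simp: elements_mat_def)

lemma matsD: "B \<in> mats K p q \<Longrightarrow> B \<in> carrier_mat p q"
  by (simp add: mats_iff)

locale scalars =
  fixes K :: "complex set"
  assumes K: "K = \<real> \<or> K = UNIV"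
begin

lemma K_closed:
  "complex_of_real r \<in> K" "a \<in> K \<Longrightarrow> b \<in> K \<Longrightarrow> a + b \<in> K" "a \<in> K \<Longrightarrow> b \<in> K \<Longrightarrow> a - b \<in> K"
  "a \<in> K \<Longrightarrow> b \<in> K \<Longrightarrow> a * b \<in> K" "a \<in> K \<Longrightarrow> cnj a \<in> K" "0 \<in> K" "1 \<in> K"
  "(\<And>i. i \<in> S \<Longrightarrow> f i \<in> K) \<Longrightarrow> sum f S \<in> K"
  using K by (auto simp: Reals_cnj_iff)

lemma mats_add: "B \<in> mats K p q \<Longrightarrow> D \<in> mats K p q \<Longrightarrow> B + D \<in> mats K p q"
  by (auto simp: mats_iff K_closed)

lemma mats_minus: "B \<in> mats K p q \<Longrightarrow> D \<in> mats K p q \<Longrightarrow> B - D \<in> mats K p q"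
  unfolding mats_iff by (auto simp: K_closed)

lemma mats_smult: "c \<in> K \<Longrightarrow> B \<in> mats K p q \<Longrightarrow> c \<cdot>\<^sub>m B \<in> mats K p q"
  by (auto simp: mats_iff K_closed)

lemma mats_mult: "B \<in> mats K p q \<Longrightarrow> D \<in> mats K q r \<Longrightarrow> B * D \<in> mats K p r"
  unfolding mats_iff
  by (auto simp: mat_mult_index K_closed intro!: K_closed simp del: index_mult_mat(1))

lemma mats_adjoint: "B \<in> mats K p q \<Longrightarrow> mat_adjoint B \<in> mats K q p"
  by (auto simp: mats_iff K_closed)

lemma mats_one: "1\<^sub>m n \<in> mats K n n"
  by (auto simp: mats_iff K_closed)

lemma mats_rdiag: "rdiag p q s \<in> mats K p q"
  by (auto simp: mats_iff K_closed)

end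

locale unitarily_generated_norm = scalars +
  fixes nrm :: "complex mat \<Rightarrow> real"
  assumes family: "norm_family K nrm" and normed: "normalized K nrm"
    and generated: "uniformly_generated K nrm" and invariant: "unitarily_invariant K nrm"
begin

lemma
  assumes "B \<in> mats K p q" "1 \<le> p" "1 \<le> q"
  shows nrm_nonneg: "0 \<le> nrm B"
    and nrm_smult: "c \<in> K \<Longrightarrow> nrm (c \<cdot>\<^sub>m B) = cmod c * nrm B"
    and nrm_triangle: "D \<in> mats K p q \<Longrightarrow> nrm (B + D) \<le> nrm B + nrm D"
  using family assms unfolding norm_family_def by blast+

lemma nrm_triangle_minus:
  assumes "B \<in> mats K p q" "D \<in> mats K p q" "1 \<le> p" "1 \<le> q"
  shows "nrm (B - D) \<le> nrm B + nrm D"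
proof -
  have "B - D = B + (- 1) \<cdot>\<^sub>m D" by (rule eq_matI) (use assms in \<open>auto simp: mats_iff\<close>)
  moreover have m1: "- 1 \<in> K" using K_closed(1)[of "-1"] by simp
  ultimately show ?thesis
    using nrm_triangle[OF assms(1,3,4) mats_smult[OF m1 assms(2)]] nrm_smult[OF assms(2-4) m1] by simp
qed

lemma nrm_cong_sigma:
  assumes "B \<in> mats K p q" "1 \<le> p" "1 \<le> q" "D \<in> mats K p' q'" "1 \<le> p'" "1 \<le> q'"
    and "sigma B = sigma D"
  shows "nrm B = nrm D"
proof -
  obtain \<phi> where "\<And>p q B. 1 \<le> p \<Longrightarrow> 1 \<le> q \<Longrightarrow> B \<in> mats K p q \<Longrightarrow>
      nrm B = (\<phi> :: real list \<Rightarrow> real) (take (mrank B) (singular_values B))"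
    using generated unfolding uniformly_generated_def by blast
  then show ?thesis
    using assms mrank_cong_sigma[OF assms(7)] by (simp add: take_mrank_singular_values)
qed

text \<open>Shrinking one diagonal entry does not increase the norm: the shrunk matrix is a convex
  combination of the original one and of the one with the sign of this entry reversed, and both have
  the same norm.\<close>

lemma nrm_rdiag_shrink:
  assumes N: "1 \<le> N" and c: "0 \<le> c" "c \<le> 1"
  shows "nrm (rdiag N N (s(m := c * s m))) \<le> nrm (rdiag N N s)"
proof -
  define S where "S = rdiag N N (\<lambda>i. if i = m then -1 else 1)"
  have "S * S = 1\<^sub>m N" unfolding S_def rdiag_mult by (rule eq_matI) auto
  then have S: "S \<in> unitary_mats K N"
    using mats_rdiag by (auto simp: unitary_mats_def S_def)
  have one: "1\<^sub>m N \<in> unitary_mats K N" using mats_one by (auto simp: unitary_mats_def)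
  let ?D = "rdiag N N s"
  let ?a = "complex_of_real ((1 + c) / 2)" and ?b = "complex_of_real ((1 - c) / 2)"
  have D: "?D \<in> mats K N N" by (rule mats_rdiag)
  have SD: "S * ?D * 1\<^sub>m N \<in> mats K N N" using S by (auto simp: unitary_mats_def intro!: mats_mult D mats_one)
  have "rdiag N N (s(m := c * s m)) = ?a \<cdot>\<^sub>m ?D + ?b \<cdot>\<^sub>m (S * ?D * 1\<^sub>m N)"
    unfolding S_def rdiag_mult right_mult_one_mat[OF rdiag_carrier]
    by (rule eq_matI) (auto simp: field_simps)
  then have "nrm (rdiag N N (s(m := c * s m))) \<le> nrm (?a \<cdot>\<^sub>m ?D) + nrm (?b \<cdot>\<^sub>m (S * ?D * 1\<^sub>m N))"
    by (simp only: nrm_triangle[OF mats_smult[OF K_closed(1) D] N N mats_smult[OF K_closed(1) SD]])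
  also have "\<dots> = \<bar>(1 + c) / 2\<bar> * nrm ?D + \<bar>(1 - c) / 2\<bar> * nrm (S * ?D * 1\<^sub>m N)"
    unfolding nrm_smult[OF D N N K_closed(1)] nrm_smult[OF SD N N K_closed(1)] norm_of_real ..
  also have "nrm (S * ?D * 1\<^sub>m N) = nrm ?D"
    using invariant N D S one unfolding unitarily_invariant_def by blast
  also have "\<bar>(1 + c) / 2\<bar> * nrm ?D + \<bar>(1 - c) / 2\<bar> * nrm ?D = nrm ?D"
    using c by (simp add: field_simps)
  finally show ?thesis .
qed

lemma nrm_rdiag_mono:
  assumes N: "1 \<le> N" and s: "\<And>i. i < N \<Longrightarrow> 0 \<le> s i" "\<And>i. i < N \<Longrightarrow> s i \<le> s' i"
  shows "nrm (rdiag N N s) \<le> nrm (rdiag N N s')"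
proof -
  have "nrm (rdiag N N (\<lambda>i. if i < m then s i else s' i)) \<le> nrm (rdiag N N s')" if "m \<le> N" for m
    using that
  proof (induction m)
    case (Suc m)
    let ?t = "\<lambda>i. if i < m then s i else s' i"
    have sm: "0 \<le> s m" "s m \<le> s' m" using s Suc.prems by auto
    have "(\<lambda>i. if i < Suc m then s i else s' i) = ?t(m := s m / s' m * ?t m)"
      using sm by (auto simp: fun_eq_iff less_Suc_eq)
    moreover have "0 \<le> s m / s' m" "s m / s' m \<le> 1"
      using sm by (auto simp: divide_le_eq_1)
    ultimately have "nrm (rdiag N N (\<lambda>i. if i < Suc m then s i else s' i)) \<le> nrm (rdiag N N ?t)"
      using nrm_rdiag_shrink[OF N, of "s m / s' m" ?t m] by metis
    also have "\<dots> \<le> nrm (rdiag N N s')" using Suc by simp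
    finally show ?case .
  qed simp
  from this[of N] show ?thesis
    using rdiag_cong[of N N "\<lambda>i. if i < N then s i else s' i" s] by simp
qed

text \<open>Matrices of different sizes can be compared: the norm of a matrix is that of a large square
  diagonal matrix with the same singular values.\<close>

theorem nrm_dominated:
  assumes B: "B \<in> mats K p q" "1 \<le> p" "1 \<le> q" and D: "D \<in> mats K p' q'" "1 \<le> p'" "1 \<le> q'"
    and c: "0 \<le> c" and le: "\<And>i. sigma B i \<le> c * sigma D i"
  shows "nrm B \<le> c * nrm D"
proof -
  define N where "N = max p p'"
  have N: "1 \<le> N" using B by (simp add: N_def)
  have sig: "sigma (rdiag N N (sigma F)) = sigma F" if "dim_row F \<le> N" for F
  proof
    fix i
    have "sigma F i = 0" if "N \<le> i"
      using that \<open>dim_row F \<le> N\<close> by (simp add: sigma_def length_singular_values)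
    then show "sigma (rdiag N N (sigma F)) i = sigma F i"
      by (subst sigma_rdiag) (auto intro: sigma_antimono)
  qed
  have "nrm B = nrm (rdiag N N (sigma B))"
    by (rule nrm_cong_sigma[OF B mats_rdiag N N]) (use sig[of B] matsD[OF B(1)] in \<open>auto simp: N_def\<close>)
  also have "\<dots> \<le> nrm (rdiag N N (\<lambda>i. c * sigma D i))"
    by (rule nrm_rdiag_mono[OF N]) (use le in auto)
  also have "rdiag N N (\<lambda>i. c * sigma D i) = complex_of_real c \<cdot>\<^sub>m rdiag N N (sigma D)"
    by (rule eq_matI) auto
  also have "nrm \<dots> = c * nrm (rdiag N N (sigma D))"
    unfolding nrm_smult[OF mats_rdiag N N K_closed(1)] norm_of_real using c by simp
  also have "nrm (rdiag N N (sigma D)) = nrm D"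
    by (rule nrm_cong_sigma[OF mats_rdiag N N D]) (use sig[of D] matsD[OF D(1)] in \<open>auto simp: N_def\<close>)
  finally show ?thesis .
qed

text \<open>Only the product has to be a matrix over \<open>K\<close>. Interpolating factors, which contain inverses of Gram
  matrices, can therefore be pulled out by their operator bounds alone.\<close>

corollary nrm_product_le:
  assumes D: "D \<in> mats K p' q'" "1 \<le> p'" "1 \<le> q'" and B: "B \<in> mats K p q" "1 \<le> p" "1 \<le> q"
    and eq: "D = X * B * Y"
    and X: "op_bound X x" "dim_col X = p" and Y: "op_bound Y y" "dim_row Y = q"
  shows "nrm D \<le> x * y * nrm B"
proof (rule nrm_dominated[OF D B])
  show "0 \<le> x * y" using X Y by (simp add: op_bound_def)
  show "sigma D i \<le> x * y * sigma B i" for i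
    unfolding eq by (rule sigma_mult_le) (use X Y matsD[OF B(1)] in auto)
qed

text \<open>Every norm of this kind dominates the spectral norm: compare \<open>B\<close> with the matrix whose single
  entry is the largest singular value of \<open>B\<close>, of which the norm is known by normalization.\<close>

lemma op_bound_nrm:
  assumes B: "B \<in> mats K p q" "1 \<le> p" "1 \<le> q"
  shows "op_bound B (nrm B)"
proof -
  let ?D = "rdiag 1 1 (\<lambda>_. sigma B 0)"
  have "nrm ?D \<le> 1 * nrm B"
  proof (rule nrm_dominated[OF mats_rdiag _ _ B])
    show "sigma ?D i \<le> 1 * sigma B i" for i by (subst sigma_rdiag) auto
  qed auto
  moreover have "nrm ?D = sigma B 0"
    using normed mats_rdiag[of 1 1] unfolding normalized_def by auto
  ultimately show ?thesis using op_bound_mono[OF sigma_0_op_bound] by simp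
qed

end

section \<open>Truncated singular value decompositions and pseudoinverses\<close>

text \<open>Two pseudoinverses yield the same projections \<open>B X\<close> and \<open>X B\<close>: each product absorbs the other one
  on one side, and taking adjoints moves it to the other side.\<close>

lemma is_pinv_unique:
  assumes X: "is_pinv B X" and Y: "is_pinv B Y"
  shows "X = Y"
proof -
  have XY: "X' * B * Y' = X'" if "is_pinv B X'" "is_pinv B Y'" for X' Y'
  proof -
    from that have d: "dim_row X' = dim_col B" "dim_col X' = dim_row B"
      "dim_row Y' = dim_col B" "dim_col Y' = dim_row B"
      and x: "B * X' * B = B" "X' * B * X' = X'" "mat_adjoint (B * X') = B * X'"
      and y: "B * Y' * B = B" "mat_adjoint (B * Y') = B * Y'"
      by (auto simp: is_pinv_def)
    have "B * X' = B * Y' * (B * X')"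
      using d y(1) by (metis mat_assoc index_mult_mat(2,3))
    then have "mat_adjoint (B * X') = mat_adjoint (B * X') * mat_adjoint (B * Y')"
      using d mat_adjoint_mult[of "B * Y'" "B * X'"] by simp
    then have "B * X' = B * X' * (B * Y')" unfolding x(3) y(2) .
    also have "\<dots> = B * X' * B * Y'" using d by (intro mat_assoc[symmetric]) auto
    finally have eq: "B * X' = B * Y'" unfolding x(1) .
    have "X' * B * Y' = X' * (B * Y')" using d by (intro mat_assoc) auto
    also have "\<dots> = X' * B * X'" unfolding eq[symmetric] using d by (intro mat_assoc[symmetric]) auto
    finally show ?thesis using x(2) by simp
  qed
  have d: "dim_row X = dim_col B" "dim_col X = dim_row B"
      "dim_row Y = dim_col B" "dim_col Y = dim_row B"
    and x: "mat_adjoint (X * B) = X * B" and y: "mat_adjoint (Y * B) = Y * B"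
    using X Y by (auto simp: is_pinv_def)
  have "X * B = X * B * (Y * B)" using XY[OF X Y] d by (simp add: mat_assoc[symmetric])
  then have "mat_adjoint (X * B) = mat_adjoint (Y * B) * mat_adjoint (X * B)"
    using d mat_adjoint_mult[of "X * B" "Y * B"] by simp
  then have "X * B = Y * B * (X * B)" unfolding x y .
  also have "\<dots> = Y * B * X * B" using d by (intro mat_assoc[symmetric]) auto
  finally have "X * B = Y * B" using XY[OF Y X] by simp
  then show ?thesis using XY[OF X Y] XY[OF Y X] Y by (simp add: is_pinv_def)
qed

lemma pinv_eqI: "is_pinv B X \<Longrightarrow> pinv B = X"
  unfolding pinv_def by (rule the_equality) (auto intro: is_pinv_unique)

lemma pinv_projections:
  assumes X: "is_pinv B X" and B: "B \<in> carrier_mat p q"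
  shows "op_bound (B * X) 1" "op_bound (1\<^sub>m p - B * X) 1" "op_bound (X * B) 1" "op_bound (1\<^sub>m q - X * B) 1"
proof -
  have d: "X \<in> carrier_mat q p" and x: "B * X * B = B" "X * B * X = X"
    "mat_adjoint (B * X) = B * X" "mat_adjoint (X * B) = X * B"
    using X B by (auto simp: is_pinv_def)
  have l: "B * X * (B * X) = B * X" using x(1) d B mat_assoc[of "B * X" B X] by simp
  have r: "X * B * (X * B) = X * B" using x(2) d B mat_assoc[of "X * B" X B] by simp
  show "op_bound (B * X) 1" "op_bound (1\<^sub>m p - B * X) 1"
    using d B l x(3) by (auto intro!: op_bound_projection op_bound_projection_compl carrier_matI)
  show "op_bound (X * B) 1" "op_bound (1\<^sub>m q - X * B) 1"
    using d B r x(4) by (auto intro!: op_bound_projection op_bound_projection_compl carrier_matI)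
qed

lemma sv_mat_rdiag: "sv_mat (dim_row B) (dim_col B) r B
    = rdiag (dim_row B) (dim_col B) (\<lambda>i. if i < r then sigma B i else 0)"
  by (rule eq_matI) (auto simp: sv_mat_def sigma_sing_val)

text \<open>The tail of a diagonal matrix with decreasing entries is approximated by its first entries.\<close>

lemma sigma_rdiag_tail:
  assumes s: "\<And>i j. i \<le> j \<Longrightarrow> s j \<le> s i" "\<And>i. 0 \<le> s i"
  shows "sigma (rdiag p q (\<lambda>j. if j < k then 0 else s j)) i \<le> s (i + k)"
proof -
  let ?D = "rdiag p q (\<lambda>j. if j < k then 0 else s j)"
  define L where "L = mat p i (\<lambda>(a, b). if a = k + b then complex_of_real (s a) else 0)"
  define M where "M = mat i q (\<lambda>(b, c). if c = k + b then 1 else (0 :: complex))"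
  have "?D - L * M = rdiag p q (\<lambda>j. if j < i + k then 0 else s j)"
  proof (rule eq_matI)
    fix a c assume "a < dim_row (rdiag p q (\<lambda>j. if j < i + k then 0 else s j))"
      "c < dim_col (rdiag p q (\<lambda>j. if j < i + k then 0 else s j))"
    then have ac: "a < p" "c < q" by auto
    have "(L * M) $$ (a, c) = (\<Sum>b<i. L $$ (a, b) * M $$ (b, c))"
      using ac by (subst mat_mult_index) (auto simp: L_def M_def)
    also have "\<dots> = (\<Sum>b<i. if b = a - k then (if k \<le> a \<and> c = a then complex_of_real (s a) else 0) else 0)"
      by (rule sum.cong) (use ac in \<open>auto simp: L_def M_def\<close>)
    also have "\<dots> = (if a - k < i \<and> k \<le> a \<and> c = a then complex_of_real (s a) else 0)" by simp
    finally show "(?D - L * M) $$ (a, c) = rdiag p q (\<lambda>j. if j < i + k then 0 else s j) $$ (a, c)"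
      using ac by (auto simp: L_def M_def simp del: index_mult_mat(1))
  qed (auto simp: L_def M_def)
  moreover have "op_bound (rdiag p q (\<lambda>j. if j < i + k then 0 else s j)) (s (i + k))"
    by (rule op_bound_rdiag) (use s in auto)
  ultimately have "approximable ?D i (s (i + k))"
    by (intro approximableI[of L _ _ M]) (auto simp: L_def M_def)
  then show ?thesis using sigma_le_iff s(2) by blast
qed

lemma (in scalars) truncated_svd:
  assumes B: "B \<in> mats K p q" and tr: "is_truncated_svd K k B Bk"
  shows "Bk \<in> mats K p q" "pinv Bk \<in> mats K q p" "is_pinv Bk (pinv Bk)"
    and "pinv Bk * B = pinv Bk * Bk" "B * pinv Bk = Bk * pinv Bk"
    and "sigma (B - Bk) i \<le> sigma B (i + k)"
    and "1 \<le> k \<Longrightarrow> 0 < sigma B (k - 1) \<Longrightarrow> op_bound (pinv Bk) (1 / sigma B (k - 1))"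
proof -
  have d: "dim_row B = p" "dim_col B = q" using matsD[OF B] by auto
  let ?S = "rdiag p q (sigma B)" and ?Sk = "rdiag p q (\<lambda>i. if i < k then sigma B i else 0)"
  let ?R = "rdiag q p (\<lambda>i. if i < k then inverse (sigma B i) else 0)"
  have full: "sv_mat p q (min p q) B = ?S"
    using sv_mat_rdiag[of B "min p q"] d by (auto intro: rdiag_cong)
  have trunc: "sv_mat p q k B = ?Sk" using sv_mat_rdiag[of B k] d by simp
  obtain W V where W: "W \<in> unitary_mats K p" and V: "V \<in> unitary_mats K q"
    and BWV: "B = W * ?S * mat_adjoint V" and BkWV: "Bk = W * ?Sk * mat_adjoint V"
    using tr d unfolding is_truncated_svd_def is_svd_def full trunc by (auto simp: full trunc)
  have Wc: "W \<in> mats K p p" "mat_adjoint W * W = 1\<^sub>m p" and Vc: "V \<in> mats K q q" "mat_adjoint V * V = 1\<^sub>m q"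
    using W V by (auto simp: unitary_mats_def)
  have dims [simp]: "dim_row W = p" "dim_col W = p" "dim_row V = q" "dim_col V = q"
    using matsD[OF Wc(1)] matsD[OF Vc(1)] by auto
  have cancel: "mat_adjoint W * (W * C) = C" if "dim_row C = p" for C
    using mat_cancel[OF Wc(2)] that by simp
  have cancel': "mat_adjoint V * (V * C) = C" if "dim_row C = q" for C
    using mat_cancel[OF Vc(2)] that by simp
  define X where "X = V * ?R * mat_adjoint W"
  have dX [simp]: "dim_row X = q" "dim_col X = p" by (auto simp: X_def)
  note simps = X_def BkWV mat_assoc cancel cancel' mat_adjoint_mult
  have SkR: "?Sk * (?R * C) = rdiag p p (\<lambda>i. if i < k \<and> i < q \<and> sigma B i \<noteq> 0 then 1 else 0) * C"
    if "dim_row C = p" for C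
    using that by (subst mat_assoc[symmetric]) (auto simp: rdiag_mult intro!: arg_cong[of _ _ "\<lambda>D. D * C"] rdiag_cong)
  have RSk: "?R * (?Sk * C) = rdiag q q (\<lambda>i. if i < k \<and> i < p \<and> sigma B i \<noteq> 0 then 1 else 0) * C"
    if "dim_row C = q" for C
    using that by (subst mat_assoc[symmetric]) (auto simp: rdiag_mult intro!: arg_cong[of _ _ "\<lambda>D. D * C"] rdiag_cong)
  have SR: "?S * (?R * C) = rdiag p p (\<lambda>i. if i < k \<and> i < q \<and> sigma B i \<noteq> 0 then 1 else 0) * C"
    if "dim_row C = p" for C
    using that by (subst mat_assoc[symmetric]) (auto simp: rdiag_mult intro!: arg_cong[of _ _ "\<lambda>D. D * C"] rdiag_cong)
  have RS: "?R * (?S * C) = rdiag q q (\<lambda>i. if i < k \<and> i < p \<and> sigma B i \<noteq> 0 then 1 else 0) * C"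
    if "dim_row C = q" for C
    using that by (subst mat_assoc[symmetric]) (auto simp: rdiag_mult intro!: arg_cong[of _ _ "\<lambda>D. D * C"] rdiag_cong)
  have PS: "rdiag p p (\<lambda>i. if i < k \<and> i < q \<and> sigma B i \<noteq> 0 then 1 else 0) * (?Sk * C) = ?Sk * C"
    if "dim_row C = q" for C
    using that by (subst mat_assoc[symmetric]) (auto simp: rdiag_mult intro!: arg_cong[of _ _ "\<lambda>D. D * C"] rdiag_cong)
  have QR: "rdiag q q (\<lambda>i. if i < k \<and> i < p \<and> sigma B i \<noteq> 0 then 1 else 0) * (?R * C) = ?R * C"
    if "dim_row C = p" for C
    using that by (subst mat_assoc[symmetric]) (auto simp: rdiag_mult intro!: arg_cong[of _ _ "\<lambda>D. D * C"] rdiag_cong)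
  have pX: "is_pinv Bk X"
    unfolding is_pinv_def by (auto intro!: carrier_matI simp: simps SkR RSk PS QR)
  then have X: "pinv Bk = X" by (rule pinv_eqI)
  show "Bk \<in> mats K p q" unfolding BkWV by (rule mats_mult mats_adjoint Wc Vc mats_rdiag)+
  show "pinv Bk \<in> mats K q p" unfolding X X_def by (rule mats_mult mats_adjoint Wc Vc mats_rdiag)+
  show "is_pinv Bk (pinv Bk)" unfolding X by (rule pX)
  have XB: "X * (W * ?S * mat_adjoint V) = X * Bk" by (simp add: simps RS RSk)
  have BX: "W * ?S * mat_adjoint V * X = Bk * X" by (simp add: simps SR SkR)
  show "pinv Bk * B = pinv Bk * Bk" unfolding X using XB BWV by simp
  show "B * pinv Bk = Bk * pinv Bk" unfolding X using BX BWV by simp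
  have opW: "op_bound W 1" and opV: "op_bound V 1" using Wc Vc by (auto intro!: op_bound_isometry)
  note opad = op_bound_adjoint[OF opW] op_bound_adjoint[OF opV]
  have "W * ?S * mat_adjoint V - Bk = W * (?S - ?Sk) * mat_adjoint V"
    unfolding BkWV by (simp add: mat_distribs)
  also have "?S - ?Sk = rdiag p q (\<lambda>j. if j < k then 0 else sigma B j)"
    unfolding rdiag_minus by (rule rdiag_cong) auto
  finally have "B - Bk = W * rdiag p q (\<lambda>j. if j < k then 0 else sigma B j) * mat_adjoint V"
    using BWV by simp
  then have "sigma (B - Bk) i \<le> sigma (rdiag p q (\<lambda>j. if j < k then 0 else sigma B j)) i"
    using sigma_mult_le[OF opW opad(2), of "rdiag p q (\<lambda>j. if j < k then 0 else sigma B j)" i] by simp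
  also have "\<dots> \<le> sigma B (i + k)" by (rule sigma_rdiag_tail) (auto intro: sigma_antimono)
  finally show "sigma (B - Bk) i \<le> sigma B (i + k)" .
  assume k: "1 \<le> k" "0 < sigma B (k - 1)"
  have "op_bound ?R (1 / sigma B (k - 1))"
  proof (rule op_bound_rdiag)
    fix i
    have "sigma B (k - 1) \<le> sigma B i" if "i < k" using that by (intro sigma_antimono) auto
    then show "\<bar>if i < k then inverse (sigma B i) else 0\<bar> \<le> 1 / sigma B (k - 1)"
      using k by (auto simp: inverse_eq_divide intro: divide_left_mono)
  qed (use k in simp)
  then have "op_bound X (1 * (1 / sigma B (k - 1)) * 1)"
    unfolding X_def by (intro op_bound_mult opV opad) auto
  then show "op_bound (pinv Bk) (1 / sigma B (k - 1))" unfolding X by simp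
qed

section \<open>Submatrices as products with selection matrices\<close>

definition sel :: "nat \<Rightarrow> nat set \<Rightarrow> complex mat" where
  "sel n J = mat n (card J) (\<lambda>(i, j). if i = pick J j then 1 else 0)"

lemma sel_dim [simp]: "dim_row (sel n J) = n" "dim_col (sel n J) = card J"
  by (auto simp: sel_def)

lemma pick_bij: "finite J \<Longrightarrow> bij_betw (pick J) {..<card J} J"
  by (intro bij_betwI[of _ _ _ "\<lambda>i. card {a \<in> J. a < i}"])
    (auto simp: pick_in_set card_pick pick_card_in_set intro!: psubset_card_mono)

lemma submatrix_cols:
  assumes "J \<subseteq> {..<dim_col A}"
  shows "submatrix A UNIV J = A * sel (dim_col A) J"
proof -
  have fin: "finite J" using assms finite_subset by blast
  have c: "{j. j < dim_col A \<and> j \<in> J} = J" using assms by auto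
  show ?thesis
  proof (rule eq_matI)
    fix i j assume "i < dim_row (A * sel (dim_col A) J)" "j < dim_col (A * sel (dim_col A) J)"
    then have ij: "i < dim_row A" "j < card J" by auto
    have "pick J j \<in> J" using ij fin by (intro pick_in_set) auto
    then have pj: "pick J j < dim_col A" using assms by auto
    have "(A * sel (dim_col A) J) $$ (i, j) = (\<Sum>l<dim_col A. A $$ (i, l) * sel (dim_col A) J $$ (l, j))"
      using ij by (subst mat_mult_index) auto
    also have "\<dots> = (\<Sum>l<dim_col A. if l = pick J j then A $$ (i, l) else 0)"
      by (rule sum.cong) (use ij in \<open>auto simp: sel_def\<close>)
    also have "\<dots> = A $$ (i, pick J j)" using pj by simp
    also have "\<dots> = submatrix A UNIV J $$ (i, j)"
      using ij c by (subst submatrix_index) (auto simp: pick_UNIV)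
    finally show "submatrix A UNIV J $$ (i, j) = (A * sel (dim_col A) J) $$ (i, j)" by simp
  qed (use c in \<open>auto simp: dim_submatrix\<close>)
qed

lemma submatrix_rows:
  assumes "I \<subseteq> {..<dim_row A}"
  shows "submatrix A I UNIV = mat_adjoint (sel (dim_row A) I) * A"
proof -
  have fin: "finite I" using assms finite_subset by blast
  have c: "{i. i < dim_row A \<and> i \<in> I} = I" using assms by auto
  show ?thesis
  proof (rule eq_matI)
    fix i j assume "i < dim_row (mat_adjoint (sel (dim_row A) I) * A)"
      "j < dim_col (mat_adjoint (sel (dim_row A) I) * A)"
    then have ij: "i < card I" "j < dim_col A" by auto
    have "pick I i \<in> I" using ij fin by (intro pick_in_set) auto
    then have pi: "pick I i < dim_row A" using assms by auto
    have "(mat_adjoint (sel (dim_row A) I) * A) $$ (i, j)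
        = (\<Sum>l<dim_row A. mat_adjoint (sel (dim_row A) I) $$ (i, l) * A $$ (l, j))"
      using ij by (subst mat_mult_index) auto
    also have "\<dots> = (\<Sum>l<dim_row A. if l = pick I i then A $$ (l, j) else 0)"
      by (rule sum.cong) (use ij in \<open>auto simp: sel_def\<close>)
    also have "\<dots> = A $$ (pick I i, j)" using pi by simp
    also have "\<dots> = submatrix A I UNIV $$ (i, j)"
      using ij c by (subst submatrix_index) (auto simp: pick_UNIV)
    finally show "submatrix A I UNIV $$ (i, j) = (mat_adjoint (sel (dim_row A) I) * A) $$ (i, j)" by simp
  qed (use c in \<open>auto simp: dim_submatrix\<close>)
qed

lemma sel_isometry:
  assumes "J \<subseteq> {..<n}"
  shows "mat_adjoint (sel n J) * sel n J = 1\<^sub>m (card J)"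
proof (rule eq_matI)
  fix i j assume "i < dim_row (1\<^sub>m (card J) :: complex mat)" "j < dim_col (1\<^sub>m (card J) :: complex mat)"
  then have ij: "i < card J" "j < card J" by auto
  have fin: "finite J" using assms finite_subset by blast
  have inj: "pick J i = pick J j \<longleftrightarrow> i = j"
    using bij_betw_imp_inj_on[OF pick_bij[OF fin]] ij by (auto simp: inj_on_def)
  have "pick J j \<in> J" using ij fin by (intro pick_in_set) auto
  then have pj: "pick J j < n" using assms by auto
  have "(mat_adjoint (sel n J) * sel n J) $$ (i, j) = (\<Sum>l<n. mat_adjoint (sel n J) $$ (i, l) * sel n J $$ (l, j))"
    using ij by (subst mat_mult_index) auto
  also have "\<dots> = (\<Sum>l<n. if l = pick J j then (if i = j then 1 else 0) else 0)"
    by (rule sum.cong) (use ij inj in \<open>auto simp: sel_def\<close>)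
  finally show "(mat_adjoint (sel n J) * sel n J) $$ (i, j) = 1\<^sub>m (card J) $$ (i, j)"
    using ij pj by simp
qed auto

section \<open>Determinants and volumes\<close>

text \<open>Both sides are the determinant of the block matrix with rows \<open>(1, X)\<close> and \<open>(Y, 1)\<close>, from which
  either off-diagonal block can be eliminated by a unitriangular factor.\<close>

lemma det_one_minus_mult_commute:
  fixes X Y :: "complex mat"
  assumes X: "X \<in> carrier_mat k m" and Y: "Y \<in> carrier_mat m k"
  shows "det (1\<^sub>m k - X * Y) = det (1\<^sub>m m - Y * X)"
proof -
  define F where "F = four_block_mat (1\<^sub>m k) X Y (1\<^sub>m m)"
  have F: "F \<in> carrier_mat (k + m) (k + m)" using X Y by (simp add: F_def)
  define L where "L = four_block_mat (1\<^sub>m k) (0\<^sub>m k m) (- Y) (1\<^sub>m m)"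
  define R where "R = four_block_mat (1\<^sub>m k) (- X) (0\<^sub>m m k) (1\<^sub>m m)"
  have L: "L \<in> carrier_mat (k + m) (k + m)" "det L = 1"
    using Y by (auto simp: L_def det_four_block_mat_upper_right_zero[OF one_carrier_mat refl])
  have R: "R \<in> carrier_mat (k + m) (k + m)" "det R = 1"
    using X by (auto simp: R_def det_four_block_mat_lower_left_zero[OF one_carrier_mat _ refl])
  have "L * F = four_block_mat (1\<^sub>m k) X (0\<^sub>m m k) (1\<^sub>m m - Y * X)"
    unfolding L_def F_def using X Y
    by (subst mult_four_block_mat[of _ k k _ m _ m _ _ k _ m]) (auto intro!: arg_cong4[of _ _ _ _ _ _ _ _ four_block_mat] eq_matI)
  then have "det (L * F) = det (1\<^sub>m m - Y * X)"
    using X Y by (simp add: det_four_block_mat_lower_left_zero[OF one_carrier_mat _ refl] minus_carrier_mat)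
  moreover have "R * F = four_block_mat (1\<^sub>m k - X * Y) (0\<^sub>m k m) Y (1\<^sub>m m)"
    unfolding R_def F_def using X Y
    by (subst mult_four_block_mat[of _ k k _ m _ m _ _ k _ m]) (auto intro!: arg_cong4[of _ _ _ _ _ _ _ _ four_block_mat] eq_matI)
  then have "det (R * F) = det (1\<^sub>m k - X * Y)"
    using X Y by (simp add: det_four_block_mat_upper_right_zero[OF _ refl] minus_carrier_mat)
  ultimately show ?thesis using det_mult[OF L(1) F] det_mult[OF R(1) F] L R by simp
qed

lemma det_minus_rank_one:
  fixes G H U W :: "complex mat"
  assumes G: "G \<in> carrier_mat k k" and H: "H \<in> carrier_mat k k" "G * H = 1\<^sub>m k"
    and U: "U \<in> carrier_mat k 1" and W: "W \<in> carrier_mat 1 k"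
  shows "det (G - U * W) = det G * (1 - (W * (H * U)) $$ (0, 0))"
proof -
  have HU: "H * U \<in> carrier_mat k 1" using H U by simp
  have "G * (1\<^sub>m k - (H * U) * W) = G - U * W"
    using G H U W by (simp add: mat_distribs mat_assoc mat_cancel[OF H(2)])
  moreover have "(1\<^sub>m k - (H * U) * W) \<in> carrier_mat k k" using HU W by (auto intro!: carrier_matI)
  ultimately have "det (G - U * W) = det G * det (1\<^sub>m k - (H * U) * W)"
    using det_mult[OF G] by metis
  also have "det (1\<^sub>m k - (H * U) * W) = det (1\<^sub>m 1 - W * (H * U))"
    by (rule det_one_minus_mult_commute[OF HU W])
  also have "\<dots> = 1 - (W * (H * U)) $$ (0, 0)"
    using W HU by (subst det_single) (auto intro!: minus_carrier_mat)
  finally show ?thesis .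
qed

lemma det_rdiag: "det (rdiag n n s) = complex_of_real (\<Prod>i<n. s i)"
proof -
  have "det (rdiag n n s) = prod_list (diag_mat (rdiag n n s))"
    by (rule det_upper_triangular) (auto simp: upper_triangular_def)
  also have "\<dots> = (\<Prod>i\<leftarrow>[0..<n]. complex_of_real (s i))"
    by (auto simp: diag_mat_def intro!: arg_cong[of _ _ prod_list])
  also have "\<dots> = complex_of_real (\<Prod>i<n. s i)"
    by (simp add: prod.distinct_set_conv_list[symmetric] atLeast0LessThan)
  finally show ?thesis .
qed

lemma det_gram_volume:
  assumes B: "B \<in> carrier_mat p q" "q \<le> p"
  shows "det (mat_adjoint B * B) = complex_of_real ((volume B)\<^sup>2)"
proof (rule sigma_orthogonal_columns[OF B(1)])
  fix Z Q
  assume d: "Z \<in> carrier_mat p q" "Q \<in> carrier_mat q q"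
    "mat_adjoint Q * Q = 1\<^sub>m q" "Q * mat_adjoint Q = 1\<^sub>m q" "B = Z * mat_adjoint Q"
    "mat_adjoint Z * Z = rdiag q q (\<lambda>i. (sigma B i)\<^sup>2)"
  have "mat_adjoint B * B = Q * (mat_adjoint Z * Z) * mat_adjoint Q"
    using d(1,2) unfolding d(5) by (simp add: mat_adjoint_mult mat_assoc)
  then have "det (mat_adjoint B * B) = det Q * det (rdiag q q (\<lambda>i. (sigma B i)\<^sup>2)) * det (mat_adjoint Q)"
    unfolding d(6) using d(2) by (simp add: det_mult[of _ q])
  also have "\<dots> = det (Q * mat_adjoint Q) * det (rdiag q q (\<lambda>i. (sigma B i)\<^sup>2))"
    using d(2) by (simp add: det_mult[of _ q])
  also have "\<dots> = complex_of_real ((\<Prod>i<q. sigma B i)\<^sup>2)"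
    unfolding d(4) by (simp add: det_rdiag prod_power_distrib)
  also have "(\<Prod>i<q. sigma B i) = volume B"
  proof -
    have "volume B = (\<Prod>i = 1..q. sing_val B i)" using B by (simp add: volume_def min_absorb2)
    also have "\<dots> = (\<Prod>i<q. sing_val B (Suc i))"
      by (rule prod.reindex_bij_witness[of _ Suc "\<lambda>i. i - 1"]) auto
    also have "\<dots> = (\<Prod>i<q. sigma B i)"
      by (rule prod.cong) (use B in \<open>auto simp: sigma_sing_val\<close>)
    finally show ?thesis by simp
  qed
  finally show ?thesis .
qed

section \<open>Rows of maximal volume\<close>

text \<open>The Gram matrix of the columns of \<open>V\<close> restricted to the rows in \<open>S\<close>. Its determinant is the
  squared volume, and it changes by a matrix of rank one when a row is added or deleted.\<close>

definition gram :: "complex mat \<Rightarrow> nat set \<Rightarrow> complex mat" where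
  "gram V S = mat (dim_col V) (dim_col V) (\<lambda>(a, b). \<Sum>i\<in>S. cnj (V $$ (i, a)) * V $$ (i, b))"

lemma volume_nonneg: "0 \<le> volume B"
  unfolding volume_def
proof (rule prod_nonneg)
  fix i assume "i \<in> {1..min (dim_row B) (dim_col B)}"
  then show "0 \<le> sing_val B i" using sigma_sing_val[of "i - 1" B] sigma_nonneg[of B "i - 1"]
    by (cases i) auto
qed

lemma gram_carrier: "V \<in> carrier_mat n k \<Longrightarrow> gram V S \<in> carrier_mat k k"
  by (auto simp: gram_def)

context
  fixes V :: "complex mat" and n k :: nat and S :: "nat set"
  assumes V: "V \<in> carrier_mat n k" and S: "S \<subseteq> {..<n}"
begin

lemma submatrix_rows_dim: "submatrix V S UNIV \<in> carrier_mat (card S) k"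
  using submatrix_rows[of S V] V S by (auto intro!: carrier_matI)

lemma submatrix_rows_index:
  assumes "l < card S" "b < k"
  shows "submatrix V S UNIV $$ (l, b) = V $$ (pick S l, b)"
proof -
  have "{i. i < n \<and> i \<in> S} = S" using S by auto
  then show ?thesis using V assms by (subst submatrix_index) (auto simp: pick_UNIV)
qed

lemma pick_less: "l < card S \<Longrightarrow> pick S l < n"
  using S pick_in_set[of l S] by auto

lemma gram_submatrix: "mat_adjoint (submatrix V S UNIV) * submatrix V S UNIV = gram V S"
proof (rule eq_matI)
  fix a b assume "a < dim_row (gram V S)" "b < dim_col (gram V S)"
  then have ab: "a < k" "b < k" using V by (auto simp: gram_def)
  have "(mat_adjoint (submatrix V S UNIV) * submatrix V S UNIV) $$ (a, b)
      = (\<Sum>l<card S. mat_adjoint (submatrix V S UNIV) $$ (a, l) * submatrix V S UNIV $$ (l, b))"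
    using submatrix_rows_dim ab by (subst mat_mult_index) auto
  also have "\<dots> = (\<Sum>l<card S. cnj (V $$ (pick S l, a)) * V $$ (pick S l, b))"
    by (rule sum.cong) (use submatrix_rows_dim ab in \<open>auto simp: submatrix_rows_index\<close>)
  also have "\<dots> = (\<Sum>i\<in>S. cnj (V $$ (i, a)) * V $$ (i, b))"
    by (rule sum.reindex_bij_betw[OF pick_bij]) (use S finite_subset in blast)
  finally show "(mat_adjoint (submatrix V S UNIV) * submatrix V S UNIV) $$ (a, b) = gram V S $$ (a, b)"
    using ab V by (simp add: gram_def)
qed (use submatrix_rows_dim V in \<open>auto simp: gram_def\<close>)

lemma vnorm_submatrix_rows:
  assumes x: "dim_vec x = k"
  shows "(vnorm (submatrix V S UNIV *\<^sub>v x))\<^sup>2 = (\<Sum>i\<in>S. (cmod ((V *\<^sub>v x) $ i))\<^sup>2)"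
proof -
  have "(submatrix V S UNIV *\<^sub>v x) $ l = (V *\<^sub>v x) $ pick S l" if "l < card S" for l
    using that x V submatrix_rows_dim pick_less[of l]
    by (subst (1 2) mat_mult_vec_index) (auto simp: submatrix_rows_index intro!: sum.cong)
  then have "(vnorm (submatrix V S UNIV *\<^sub>v x))\<^sup>2 = (\<Sum>l<card S. (cmod ((V *\<^sub>v x) $ pick S l))\<^sup>2)"
    unfolding vnorm_sq using submatrix_rows_dim by auto
  also have "\<dots> = (\<Sum>i\<in>S. (cmod ((V *\<^sub>v x) $ i))\<^sup>2)"
    by (rule sum.reindex_bij_betw[OF pick_bij]) (use S finite_subset in blast)
  finally show ?thesis .
qed

lemma cinner_submatrix_rows:
  assumes "dim_vec x = k" "dim_vec y = k"
  shows "(submatrix V S UNIV *\<^sub>v x) \<bullet>c (submatrix V S UNIV *\<^sub>v y) = x \<bullet>c (gram V S *\<^sub>v y)"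
  unfolding gram_submatrix[symmetric]
  using assms submatrix_rows_dim by (simp add: mat_adjoint_cinner mat_assoc_vec)

lemma det_gram: "k \<le> card S \<Longrightarrow> det (gram V S) = complex_of_real ((volume (submatrix V S UNIV))\<^sup>2)"
  using det_gram_volume[OF submatrix_rows_dim] gram_submatrix by simp

lemma gram_inverse:
  assumes "det (gram V S) \<noteq> 0"
  obtains H where "H \<in> carrier_mat k k" "gram V S * H = 1\<^sub>m k" "H * gram V S = 1\<^sub>m k"
proof -
  note G = gram_carrier[OF V, of S]
  let ?H = "(1 / det (gram V S)) \<cdot>\<^sub>m adj_mat (gram V S)"
  have "?H \<in> carrier_mat k k" "gram V S * ?H = 1\<^sub>m k" "?H * gram V S = 1\<^sub>m k"
    using adj_mat[OF G] G assms
    by (auto simp: mult_smult_distrib[OF G] mult_smult_assoc_mat[OF _ G] intro!: eq_matI)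
  then show ?thesis using that by blast
qed

end

text \<open>Let \<open>J\<close> have maximal volume and add a row \<open>j\<close>. Deleting row \<open>i\<close> from \<open>J \<union> {j}\<close> multiplies the
  Gram determinant by one minus the leverage score \<open>h i\<close> of that row. Deleting \<open>j\<close> gives \<open>J\<close>, so
  maximality says that no row has a smaller leverage score than \<open>j\<close>. The scores add up to \<open>k\<close>,
  hence that of \<open>j\<close> is at most \<open>k / (card J + 1)\<close>, and this controls row \<open>j\<close> by the rows in \<open>J\<close>.\<close>

lemma max_volume_row_bound:
  assumes V: "V \<in> carrier_mat n k" and J: "J \<subseteq> {..<n}" and kJ: "k \<le> card J"
    and maxvol: "max_volume_rows V J" and det: "det (gram V J) \<noteq> 0"
    and j: "j < n" "j \<notin> J" and x: "dim_vec x = k"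
  shows "(real (card J) - real k + 1) * (cmod ((V *\<^sub>v x) $ j))\<^sup>2
      \<le> real k * (\<Sum>i\<in>J. (cmod ((V *\<^sub>v x) $ i))\<^sup>2)"
proof -
  define J' where "J' = insert j J"
  define G where "G = gram V J'"
  have finJ: "finite J" using J finite_subset by blast
  have J': "J' \<subseteq> {..<n}" "finite J'" using J j finJ by (auto simp: J'_def)
  have cJ': "card J' = card J + 1" using finJ j by (simp add: J'_def)
  have G: "G \<in> carrier_mat k k" using gram_carrier[OF V] by (simp add: G_def)
  have detG: "det G \<noteq> 0"
  proof
    assume "det G = 0"
    then obtain y where y: "y \<in> carrier_vec k" "y \<noteq> 0\<^sub>v k" "G *\<^sub>v y = 0\<^sub>v k"
      using det_0_iff_vec_prod_zero_field[OF G] by blast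
    have yd: "dim_vec y = k" using y by auto
    have "y \<bullet>c (G *\<^sub>v y) = 0" unfolding y(3) using y(1) by (auto simp: scalar_prod_def)
    then have "(vnorm (submatrix V J' UNIV *\<^sub>v y))\<^sup>2 = 0"
      using cinner_submatrix_rows[OF V J'(1) yd yd] by (simp add: cinner_self G_def)
    then have "(\<Sum>i\<in>J'. (cmod ((V *\<^sub>v y) $ i))\<^sup>2) = 0"
      using vnorm_submatrix_rows[OF V J'(1) yd] by simp
    then have "(\<Sum>i\<in>J. (cmod ((V *\<^sub>v y) $ i))\<^sup>2) = 0"
      using J'(2) finJ by (auto simp: sum_nonneg_eq_0_iff J'_def)
    then have "vnorm (submatrix V J UNIV *\<^sub>v y) = 0"
      using vnorm_submatrix_rows[OF V J yd] by simp
    then have "submatrix V J UNIV *\<^sub>v y = 0\<^sub>v (card J)"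
      using submatrix_rows_dim[OF V J] by (simp add: vnorm_eq_0)
    then have "gram V J *\<^sub>v y = 0\<^sub>v k"
      unfolding gram_submatrix[OF V J, symmetric]
      using submatrix_rows_dim[OF V J] yd by (auto simp: mat_assoc_vec scalar_prod_def)
    then show False using det y det_0_iff_vec_prod_zero_field[OF gram_carrier[OF V]] by blast
  qed
  obtain H where H: "H \<in> carrier_mat k k" "G * H = 1\<^sub>m k" "H * G = 1\<^sub>m k"
    using gram_inverse[OF V J'(1)] detG by (auto simp: G_def)
  \<comment> \<open>Leverage scores; that these complex numbers are real follows from the determinant formula.\<close>
  define h where "h i = (\<Sum>a<k. V $$ (i, a) * (\<Sum>b<k. H $$ (a, b) * cnj (V $$ (i, b))))" for i
  define vol where "vol T = (volume (submatrix V T UNIV))\<^sup>2" for T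
  define g where "g = vol J'"
  have detg: "det G = complex_of_real g"
    using det_gram[OF V J'(1)] kJ cJ' by (simp add: G_def g_def vol_def)
  have g: "g > 0" using detg detG by (auto simp: g_def vol_def)

  have sum_h: "(\<Sum>i\<in>J'. h i) = of_nat k"
  proof -
    have "(\<Sum>i\<in>J'. h i) = (\<Sum>a<k. \<Sum>b<k. \<Sum>i\<in>J'. V $$ (i, a) * (H $$ (a, b) * cnj (V $$ (i, b))))"
      unfolding h_def sum_distrib_left by (subst sum.swap, subst (2) sum.swap) (rule refl)
    also have "\<dots> = (\<Sum>a<k. \<Sum>b<k. H $$ (a, b) * G $$ (b, a))"
      using V by (auto simp: G_def gram_def sum_distrib_left mult_ac intro!: sum.cong)
    also have "\<dots> = (\<Sum>a<k. (H * G) $$ (a, a))"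
      by (intro sum.cong refl, subst mat_mult_index) (use H(1) G in auto)
    also have "\<dots> = of_nat k" unfolding H(3) by simp
    finally show ?thesis .
  qed

  have delete: "det (gram V (J' - {i})) = det G * (1 - h i)" if i: "i \<in> J'" for i
  proof -
    define u where "u = mat k 1 (\<lambda>(a, _). cnj (V $$ (i, a)))"
    define w where "w = mat 1 k (\<lambda>(_, b). V $$ (i, b))"
    have "gram V (J' - {i}) = G - u * w"
    proof (rule eq_matI)
      fix a b assume "a < dim_row (G - u * w)" "b < dim_col (G - u * w)"
      then have ab: "a < k" "b < k" by (auto simp: u_def w_def)
      have "(u * w) $$ (a, b) = cnj (V $$ (i, a)) * V $$ (i, b)"
        using ab by (subst mat_mult_index) (auto simp: u_def w_def)
      then show "gram V (J' - {i}) $$ (a, b) = (G - u * w) $$ (a, b)"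
        using ab V i J'(2) by (simp add: G_def gram_def u_def w_def sum_diff1 del: index_mult_mat(1))
    qed (use V in \<open>auto simp: gram_def u_def w_def\<close>)
    moreover have "(w * (H * u)) $$ (0, 0) = h i"
    proof -
      have "(w * (H * u)) $$ (0, 0) = (\<Sum>a<k. w $$ (0, a) * (H * u) $$ (a, 0))"
        using H by (subst mat_mult_index) (auto simp: u_def w_def)
      also have "\<dots> = (\<Sum>a<k. V $$ (i, a) * (\<Sum>b<k. H $$ (a, b) * u $$ (b, 0)))"
        using H by (auto simp: w_def mat_mult_index u_def simp del: index_mult_mat(1) intro!: sum.cong)
      also have "\<dots> = h i" by (auto simp: h_def u_def intro!: sum.cong)
      finally show ?thesis .
    qed
    ultimately show ?thesis
      using det_minus_rank_one[OF G H(1,2), of u w] by (simp add: u_def w_def)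
  qed
  define r where "r i = 1 - vol (J' - {i}) / g" for i
  have card_del: "card (J' - {i}) = card J" if "i \<in> J'" for i using that J'(2) cJ' by simp
  have h_real: "h i = complex_of_real (r i)" if i: "i \<in> J'" for i
  proof -
    have "complex_of_real (vol (J' - {i})) = complex_of_real g * (1 - h i)"
      using delete[OF i] det_gram[OF V, of "J' - {i}"] subset_trans[OF Diff_subset J'(1)]
        card_del[OF i] kJ
      unfolding detg vol_def by simp
    then show ?thesis using g by (simp add: r_def field_simps)
  qed
  have sum_r: "(\<Sum>i\<in>J'. r i) = real k"
  proof -
    have "complex_of_real (\<Sum>i\<in>J'. r i) = complex_of_real (real k)"
      using sum_h h_real by simp
    then show ?thesis using of_real_eq_iff by blast
  qed
  have "r j \<le> r i" if i: "i \<in> J'" for i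
  proof -
    have sub: "J' - {i} \<subseteq> {..<n}" using J' by auto
    have "volume (submatrix V (J' - {i}) UNIV) \<le> volume (submatrix V J UNIV)"
      using maxvol V sub card_del[OF i] unfolding max_volume_rows_def by auto
    then have "vol (J' - {i}) \<le> vol J" unfolding vol_def by (rule power_mono) (rule volume_nonneg)
    moreover have "J' - {j} = J" using j by (auto simp: J'_def)
    ultimately show ?thesis using g by (simp add: r_def divide_right_mono)
  qed
  then have "real (card J') * r j \<le> (\<Sum>i\<in>J'. r i)" using sum_bounded_below[of J' "r j" r] by simp
  then have rj: "(real (card J) + 1) * r j \<le> real k" unfolding sum_r cJ' by (simp add: add.commute)

  \<comment> \<open>The \<open>j\<close>-th entry of \<open>V x\<close> is \<open>\<langle>x, u\<rangle> = \<langle>x, G y\<rangle>\<close>. By the Cauchy-Schwarz inequality for \<open>G\<close> it is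
    bounded in terms of \<open>\<langle>y, G y\<rangle>\<close>, which is the leverage score of \<open>j\<close>.\<close>
  define u where "u = vec k (\<lambda>a. cnj (V $$ (j, a)))"
  define y where "y = H *\<^sub>v u"
  have u: "dim_vec u = k" by (simp add: u_def)
  have y: "dim_vec y = k" using H by (simp add: y_def)
  have Gy: "gram V J' *\<^sub>v y = u"
    using mat_cancel_vec[OF H(2), of u] G H u by (simp add: y_def G_def)
  have Vj: "(V *\<^sub>v z) $ j = z \<bullet>c u" if "dim_vec z = k" for z
    using that V j by (subst mat_mult_vec_index) (auto simp: u_def scalar_prod_def atLeast0LessThan mult.commute)
  let ?M = "submatrix V J' UNIV"
  have "y \<bullet>c u = h j"
    unfolding y_def u_def h_def scalar_prod_def using H
    by (auto simp: mat_mult_vec_index atLeast0LessThan mult.commute intro!: sum.cong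
        simp del: index_mult_mat_vec)
  then have "(vnorm (?M *\<^sub>v y))\<^sup>2 = r j"
    using cinner_submatrix_rows[OF V J'(1) y y] h_real[of j]
    by (simp only: Gy cinner_self) (simp add: J'_def del: of_real_power)
  moreover have "(cmod ((V *\<^sub>v x) $ j))\<^sup>2 \<le> (vnorm (?M *\<^sub>v x) * vnorm (?M *\<^sub>v y))\<^sup>2"
    unfolding Vj[OF x] Gy[symmetric] cinner_submatrix_rows[OF V J'(1) x y, symmetric]
    by (intro power_mono cauchy_schwarz) auto
  ultimately have "(cmod ((V *\<^sub>v x) $ j))\<^sup>2 \<le> (vnorm (?M *\<^sub>v x))\<^sup>2 * r j"
    by (simp add: power_mult_distrib)
  then have "(real (card J) + 1) * (cmod ((V *\<^sub>v x) $ j))\<^sup>2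
      \<le> (real (card J) + 1) * ((vnorm (?M *\<^sub>v x))\<^sup>2 * r j)" by (rule mult_left_mono) simp
  also have "\<dots> = (vnorm (?M *\<^sub>v x))\<^sup>2 * ((real (card J) + 1) * r j)" by simp
  also have "\<dots> \<le> (vnorm (?M *\<^sub>v x))\<^sup>2 * real k" using rj by (rule mult_left_mono) simp
  also have "(vnorm (?M *\<^sub>v x))\<^sup>2 = (cmod ((V *\<^sub>v x) $ j))\<^sup>2 + (\<Sum>i\<in>J. (cmod ((V *\<^sub>v x) $ i))\<^sup>2)"
    unfolding vnorm_submatrix_rows[OF V J'(1) x] unfolding J'_def using finJ j by simp
  finally show ?thesis by (simp add: algebra_simps)
qed

text \<open>The rows outside \<open>J\<close> number \<open>n - card J\<close>, and each of them contributes at most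
  \<open>k / (card J - k + 1)\<close> times the contribution of all rows in \<open>J\<close> to the norm of \<open>V x\<close>.\<close>

theorem max_volume_lower_bound:
  assumes V: "V \<in> carrier_mat n k" "mat_adjoint V * V = 1\<^sub>m k"
    and J: "J \<subseteq> {..<n}" and kJ: "k \<le> card J"
    and maxvol: "max_volume_rows V J" and det: "det (gram V J) \<noteq> 0" and x: "dim_vec x = k"
  shows "vnorm x \<le> sqrt (1 + real k * (real n - real (card J)) / (real (card J) - real k + 1))
      * vnorm (submatrix V J UNIV *\<^sub>v x)"
proof -
  define q where "q = real k / (real (card J) - real k + 1)"
  define s where "s = (\<Sum>i\<in>J. (cmod ((V *\<^sub>v x) $ i))\<^sup>2)"
  have finJ: "finite J" using J finite_subset by blast
  have cJ: "card J \<le> n" using card_mono[OF _ J] by simp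
  have pos: "0 < real (card J) - real k + 1" using kJ by simp
  have out: "(cmod ((V *\<^sub>v x) $ j))\<^sup>2 \<le> q * s" if "j \<in> {..<n} - J" for j
    using max_volume_row_bound[OF V(1) J kJ maxvol det _ _ x, of j] that pos
    by (simp add: q_def s_def field_simps)
  have "(vnorm x)\<^sup>2 = (vnorm (V *\<^sub>v x))\<^sup>2" using vnorm_isometry[of V x] V x by simp
  also have "\<dots> = (\<Sum>i<n. (cmod ((V *\<^sub>v x) $ i))\<^sup>2)" using V by (simp add: vnorm_sq)
  also have "\<dots> = (\<Sum>i\<in>{..<n} - J. (cmod ((V *\<^sub>v x) $ i))\<^sup>2) + s"
    unfolding s_def using J by (intro sum.subset_diff) auto
  also have "\<dots> \<le> real (card ({..<n} - J)) * (q * s) + s"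
    using sum_bounded_above[of "{..<n} - J" "\<lambda>i. (cmod ((V *\<^sub>v x) $ i))\<^sup>2" "q * s"] out by simp
  also have "real (card ({..<n} - J)) = real n - real (card J)"
    using card_Diff_subset[OF finJ J] cJ by simp
  also have "(real n - real (card J)) * (q * s) + s
      = (1 + real k * (real n - real (card J)) / (real (card J) - real k + 1)) * s"
    by (simp add: q_def field_simps)
  also have "s = (vnorm (submatrix V J UNIV *\<^sub>v x))\<^sup>2"
    unfolding s_def vnorm_submatrix_rows[OF V(1) J x] ..
  finally have "sqrt ((vnorm x)\<^sup>2) \<le> sqrt ((1 + real k * (real n - real (card J)) / (real (card J) - real k + 1))
      * (vnorm (submatrix V J UNIV *\<^sub>v x))\<^sup>2)" by (rule real_sqrt_le_mono)
  then show ?thesis by (simp add: real_sqrt_mult)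
qed

text \<open>The rows in \<open>J\<close> interpolate all of them: \<open>V\<^sup>*\<close> is a combination of the selected columns of \<open>V\<^sup>*\<close>,
  with the pseudoinverse of \<open>V\<^sub>J\<^sup>*\<close> as coefficients.\<close>

corollary max_volume_interpolation:
  assumes V: "V \<in> carrier_mat n k" "mat_adjoint V * V = 1\<^sub>m k"
    and J: "J \<subseteq> {..<n}" and kJ: "k \<le> card J"
    and maxvol: "max_volume_rows V J" and det: "det (gram V J) \<noteq> 0"
  obtains Y where "Y \<in> carrier_mat (card J) n" "mat_adjoint (submatrix V J UNIV) * Y = mat_adjoint V"
    "op_bound Y (sqrt (1 + real k * (real n - real (card J)) / (real (card J) - real k + 1)))"
proof -
  let ?t = "sqrt (1 + real k * (real n - real (card J)) / (real (card J) - real k + 1))"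
  let ?M = "submatrix V J UNIV"
  note M = submatrix_rows_dim[OF V(1) J]
  obtain H where H: "H \<in> carrier_mat k k" "gram V J * H = 1\<^sub>m k" using gram_inverse[OF V(1) J det] by metis
  define Y where "Y = ?M * (H * mat_adjoint V)"
  have Y: "Y \<in> carrier_mat (card J) n" using M H V by (auto simp: Y_def intro!: carrier_matI)
  have "mat_adjoint ?M * Y = gram V J * (H * mat_adjoint V)"
    unfolding gram_submatrix[OF V(1) J, symmetric] Y_def using M H V by (simp add: mat_assoc)
  also have "\<dots> = mat_adjoint V"
    using H V gram_carrier[OF V(1), of J] by (intro mat_cancel[OF H(2)]) auto
  finally have MY: "mat_adjoint ?M * Y = mat_adjoint V" .
  have cJ: "card J \<le> n" using card_mono[OF _ J] by simp
  have t: "0 \<le> ?t" using kJ cJ by (intro real_sqrt_ge_zero add_nonneg_nonneg divide_nonneg_nonneg mult_nonneg_nonneg) auto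
  have opV: "op_bound V 1" using V by (intro op_bound_isometry) auto
  have "op_bound Y ?t"
    unfolding op_bound_def
  proof (intro conjI ballI)
    fix x :: "complex vec" assume "x \<in> carrier_vec (dim_col Y)"
    then have x: "dim_vec x = n" using Y by auto
    define z where "z = H *\<^sub>v (mat_adjoint V *\<^sub>v x)"
    have z: "dim_vec z = k" using H by (simp add: z_def)
    have Yx: "Y *\<^sub>v x = ?M *\<^sub>v z" using M H V x by (simp add: Y_def z_def mat_assoc_vec)
    have "(Y *\<^sub>v x) \<bullet>c (Y *\<^sub>v x) = x \<bullet>c (V *\<^sub>v z)"
    proof -
      have "(Y *\<^sub>v x) \<bullet>c (?M *\<^sub>v z) = (mat_adjoint ?M *\<^sub>v (Y *\<^sub>v x)) \<bullet>c z"
        using M Y z by (subst mat_adjoint_cinner) auto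
      also have "mat_adjoint ?M *\<^sub>v (Y *\<^sub>v x) = mat_adjoint V *\<^sub>v x"
        unfolding MY[symmetric] using M Y x by (intro mat_assoc_vec[symmetric]) auto
      also have "(mat_adjoint V *\<^sub>v x) \<bullet>c z = x \<bullet>c (V *\<^sub>v z)"
        using V x z by (subst mat_adjoint_cinner) auto
      finally show ?thesis unfolding Yx .
    qed
    moreover have "vnorm (V *\<^sub>v z) \<le> ?t * vnorm (Y *\<^sub>v x)"
      using max_volume_lower_bound[OF V J kJ maxvol det z] vnorm_isometry[of V z] V z
      unfolding Yx by simp
    ultimately show "vnorm (Y *\<^sub>v x) \<le> ?t * vnorm x"
      by (intro vnorm_le_of_cinner[of _ x "V *\<^sub>v z"]) (use t V x in auto)
  qed (rule t)
  then show ?thesis using that Y MY by blast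
qed

section \<open>Perturbation of the two factorizations\<close>

lemma (in scalars) mats_sel: "sel n J \<in> mats K n (card J)"
  by (auto simp: mats_iff sel_def K_closed)

lemma op_bound_sel: "J \<subseteq> {..<n} \<Longrightarrow> op_bound (sel n J) 1"
  by (rule op_bound_isometry) (simp add: sel_isometry)

context unitarily_generated_norm
begin

text \<open>Truncation is a best approximation in every norm of this kind, since
  \<open>sigma (B - B\<^sub>k) i \<le> sigma B (i + k) \<le> sigma (B - B0) i\<close>.\<close>

lemma truncation_best_approximation:
  assumes B: "B \<in> mats K p q" "B0 \<in> mats K p q" "1 \<le> p" "1 \<le> q"
    and rank: "mrank B0 \<le> k" and tr: "is_truncated_svd K k B Bk"
  shows "nrm (B - Bk) \<le> nrm (B - B0)"
proof -
  note Bk = truncated_svd[OF B(1) tr]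
  obtain L M where LM: "L \<in> carrier_mat p k" "M \<in> carrier_mat k q" "B0 = L * M"
    using mrank_factorization[OF matsD[OF B(2)] rank] by metis
  have "sigma (B - Bk) i \<le> 1 * sigma (B - B0) i" for i
    using order_trans[OF Bk(6) sigma_low_rank_le[of L B k M i]] matsD[OF B(1)] LM by simp
  then have "nrm (B - Bk) \<le> 1 * nrm (B - B0)"
    by (intro nrm_dominated[OF mats_minus[OF B(1) Bk(1)] B(3,4) mats_minus[OF B(1,2)] B(3,4)]) auto
  then show ?thesis by simp
qed

text \<open>\<open>B0\<close> itself competes with the truncation in the approximation of \<open>B0 + F\<close>.\<close>

lemma truncation_error:
  assumes B: "B0 \<in> mats K p q" "F \<in> mats K p q" "1 \<le> p" "1 \<le> q"
    and rank: "mrank B0 \<le> k" and tr: "is_truncated_svd K k (B0 + F) Bk"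
  shows "nrm (B0 - Bk) \<le> 2 * nrm F"
proof -
  note B0F = mats_add[OF B(1,2)]
  note Bk = truncated_svd[OF B0F tr]
  have d: "dim_row B0 = p" "dim_col B0 = q" "dim_row F = p" "dim_col F = q" "dim_row Bk = p" "dim_col Bk = q"
    using matsD B(1,2) Bk(1) by blast+
  have "B0 + F - B0 = F" by (rule eq_matI) (use d in auto)
  then have "nrm (B0 + F - Bk) \<le> nrm F"
    using truncation_best_approximation[OF B0F B(1,3,4) rank tr] by simp
  moreover have "B0 - Bk = (B0 + F - Bk) - F" by (rule eq_matI) (use d in auto)
  then have "nrm (B0 - Bk) \<le> nrm (B0 + F - Bk) + nrm F"
    using nrm_triangle_minus[OF mats_minus[OF B0F Bk(1)] B(2-4)] by simp
  ultimately show ?thesis by simp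
qed

text \<open>The common setting of both bounds: \<open>T\<close> and \<open>H\<close> select the columns in \<open>J\<close> and the rows in \<open>I\<close>,
  and all of \<open>A\<close> is recovered from the selected columns by \<open>Y\<close>, from the selected rows by \<open>X\<close>.\<close>

context
  fixes A E T H X Y :: "complex mat" and n p k :: nat and t :: real
  assumes A: "A \<in> mats K n n" and E: "E \<in> mats K n n" and n: "1 \<le> n" and p: "1 \<le> p"
    and T: "T \<in> mats K n p" "op_bound T 1" and H: "H \<in> mats K n p" "op_bound H 1"
    and X: "X \<in> carrier_mat n p" "op_bound X t" and Y: "Y \<in> carrier_mat p n" "op_bound Y t"
    and XA: "X * (mat_adjoint H * A) = A" and AY: "A * T * Y = A"
    and rankA: "mrank (A * T) \<le> k" "mrank (mat_adjoint H * A) \<le> k" "mrank (mat_adjoint H * A * T) \<le> k"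
begin

lemma dims:
  "dim_row A = n" "dim_col A = n" "dim_row E = n" "dim_col E = n" "dim_row T = n" "dim_col T = p"
  "dim_row H = n" "dim_col H = p" "dim_row X = n" "dim_col X = p" "dim_row Y = p" "dim_col Y = n"
  using matsD[OF A] matsD[OF E] matsD[OF T(1)] matsD[OF H(1)] X Y by auto

lemma op_bound_H_adjoint: "op_bound (mat_adjoint H) 1"
  by (rule op_bound_adjoint[OF H(2)])

lemma nrm_E_nonneg: "0 \<le> nrm E"
  by (rule nrm_nonneg[OF E n n])

lemma nrm_selected:
  shows "nrm (E * T) \<le> nrm E" "nrm (mat_adjoint H * E) \<le> nrm E" "nrm (mat_adjoint H * E * T) \<le> nrm E"
proof -
  have "nrm (E * T) \<le> 1 * 1 * nrm E"
    by (rule nrm_product_le[OF mats_mult[OF E T(1)] n p E n n _ op_bound_one _ T(2)])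
      (use dims in auto)
  moreover have "nrm (mat_adjoint H * E) \<le> 1 * 1 * nrm E"
    by (rule nrm_product_le[OF mats_mult[OF mats_adjoint[OF H(1)] E] p n E n n _ op_bound_H_adjoint _ op_bound_one])
      (use dims in auto)
  moreover have "nrm (mat_adjoint H * E * T) \<le> 1 * 1 * nrm E"
    by (rule nrm_product_le[OF mats_mult[OF mats_mult[OF mats_adjoint[OF H(1)] E] T(1)] p p E n n refl
          op_bound_H_adjoint _ T(2)])
      (use dims in auto)
  ultimately show "nrm (E * T) \<le> nrm E" "nrm (mat_adjoint H * E) \<le> nrm E"
    "nrm (mat_adjoint H * E * T) \<le> nrm E" by auto
qed

text \<open>With the projections \<open>P = C\<^sub>k C\<^sub>k\<^sup>\<dagger>\<close> and \<open>Q = R\<^sub>k\<^sup>\<dagger> R\<^sub>k\<close>, the error is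
  \<open>(1 - P) A + P A (1 - Q) - P E Q\<close>. Since \<open>A = A T Y\<close> and \<open>(1 - P) C\<^sub>k = 0\<close>, the first term is
  \<open>(1 - P) (A T - C\<^sub>k) Y\<close>, where \<open>A T - C\<^sub>k\<close> has norm at most twice that of \<open>E\<close> and \<open>Y\<close> costs a factor \<open>t\<close>.
  The second term is treated in the same way with \<open>X\<close>.\<close>

theorem projection_bound:
  assumes Ck: "is_truncated_svd K k ((A + E) * T) Ck"
    and Rk: "is_truncated_svd K k (mat_adjoint H * (A + E)) Rk"
  shows "nrm (A - Ck * pinv Ck * (A + E) * pinv Rk * Rk) \<le> (4 * t + 1) * nrm E"
proof -
  note [simp] = dims
  have C': "(A + E) * T = A * T + E * T" and R': "mat_adjoint H * (A + E) = mat_adjoint H * A + mat_adjoint H * E"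
    by (auto simp: mat_distribs)
  have AT: "A * T \<in> mats K n p" and ET: "E * T \<in> mats K n p" using A E T by (auto intro: mats_mult)
  have HA: "mat_adjoint H * A \<in> mats K p n" and HE: "mat_adjoint H * E \<in> mats K p n"
    using A E H by (auto intro: mats_mult mats_adjoint)
  note tC = truncated_svd[OF mats_add[OF AT ET] Ck[unfolded C']]
  note tR = truncated_svd[OF mats_add[OF HA HE] Rk[unfolded R']]
  define P where "P = Ck * pinv Ck"
  define Q where "Q = pinv Rk * Rk"
  have P: "P \<in> mats K n n" and Q: "Q \<in> mats K n n"
    unfolding P_def Q_def using tC(1,2) tR(1,2) by (auto intro: mats_mult)
  have [simp]: "dim_row P = n" "dim_col P = n" "dim_row Q = n" "dim_col Q = n"
    "dim_row Ck = n" "dim_col Ck = p" "dim_row Rk = p" "dim_col Rk = n"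
    "dim_row (pinv Ck) = p" "dim_col (pinv Ck) = n" "dim_row (pinv Rk) = n" "dim_col (pinv Rk) = p"
    using matsD[OF P] matsD[OF Q] matsD[OF tC(1)] matsD[OF tR(1)] matsD[OF tC(2)] matsD[OF tR(2)] by auto
  have PCk: "P * Ck = Ck" and RkQ: "Rk * Q = Rk"
    using tC(3) tR(3) by (auto simp: P_def Q_def is_pinv_def mat_assoc)
  note opP = pinv_projections[OF tC(3) matsD[OF tC(1)], folded P_def]
  note opQ = pinv_projections[OF tR(3) matsD[OF tR(1)], folded Q_def]
  have t: "0 \<le> t" using X by (simp add: op_bound_def)

  have "nrm (A - P * A) \<le> 1 * t * nrm (A * T - Ck)"
  proof (rule nrm_product_le[OF _ n n mats_minus[OF AT tC(1)] n p _ opP(2) _ Y(2)])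
    have "(1\<^sub>m n - P) * (A * T - Ck) = A * T - P * (A * T)"
    proof -
      have "(1\<^sub>m n - P) * (A * T - Ck) = (A * T - P * (A * T)) - (Ck - P * Ck)"
        by (simp add: mat_distribs)
      also have "\<dots> = A * T - P * (A * T)" unfolding PCk by (rule eq_matI) auto
      finally show ?thesis .
    qed
    then have "(1\<^sub>m n - P) * (A * T - Ck) * Y = A * T * Y - P * (A * T * Y)"
      by (simp add: mat_distribs mat_assoc)
    then show "A - P * A = (1\<^sub>m n - P) * (A * T - Ck) * Y" unfolding AY by simp
  qed (use A P in \<open>auto intro!: mats_minus mats_mult\<close>)
  also have "\<dots> \<le> 1 * t * (2 * nrm E)"
    using truncation_error[OF AT ET n p rankA(1) Ck[unfolded C']] nrm_selected(1) t
    by (intro mult_left_mono) auto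
  finally have left: "nrm (A - P * A) \<le> 2 * t * nrm E" by simp

  have "nrm (P * A - P * A * Q) \<le> (1 * t) * 1 * nrm (mat_adjoint H * A - Rk)"
  proof (rule nrm_product_le[OF _ n n mats_minus[OF HA tR(1)] p n _ op_bound_mult[OF opP(1) X(2)] _ opQ(4)])
    have "(mat_adjoint H * A - Rk) * (1\<^sub>m n - Q) = mat_adjoint H * A - mat_adjoint H * A * Q"
    proof -
      have "(mat_adjoint H * A - Rk) * (1\<^sub>m n - Q)
          = (mat_adjoint H * A - mat_adjoint H * A * Q) - (Rk - Rk * Q)"
        by (simp add: mat_distribs) (rule eq_matI, auto)
      also have "\<dots> = mat_adjoint H * A - mat_adjoint H * A * Q" unfolding RkQ by (rule eq_matI) auto
      finally show ?thesis .
    qed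
    then have "P * X * (mat_adjoint H * A - Rk) * (1\<^sub>m n - Q)
        = P * X * (mat_adjoint H * A - mat_adjoint H * A * Q)"
      using mat_assoc[of "P * X" "mat_adjoint H * A - Rk" "1\<^sub>m n - Q"] by simp
    also have "\<dots> = P * (X * (mat_adjoint H * A)) - P * (X * (mat_adjoint H * A)) * Q"
      by (simp add: mat_distribs mat_assoc)
    finally show "P * A - P * A * Q = P * X * (mat_adjoint H * A - Rk) * (1\<^sub>m n - Q)" unfolding XA by simp
  qed (use A P Q in \<open>auto intro!: mats_minus mats_mult\<close>)
  also have "\<dots> \<le> (1 * t) * 1 * (2 * nrm E)"
    using truncation_error[OF HA HE p n rankA(2) Rk[unfolded R']] nrm_selected(2) t
    by (intro mult_left_mono) auto
  finally have right: "nrm (P * A - P * A * Q) \<le> 2 * t * nrm E" by simp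

  have err: "nrm (P * E * Q) \<le> 1 * 1 * nrm E"
    by (rule nrm_product_le[OF _ n n E n n refl opP(1) _ opQ(3)])
      (use E P Q in \<open>auto intro!: mats_mult\<close>)

  have "Ck * pinv Ck * (A + E) * pinv Rk * Rk = P * A * Q + P * E * Q"
    by (simp add: P_def Q_def mat_distribs mat_assoc)
  then have "A - Ck * pinv Ck * (A + E) * pinv Rk * Rk
      = ((A - P * A) + (P * A - P * A * Q)) - P * E * Q"
    by (simp only:) (rule eq_matI, auto)
  also have "nrm \<dots> \<le> nrm ((A - P * A) + (P * A - P * A * Q)) + nrm (P * E * Q)"
    by (rule nrm_triangle_minus[OF _ _ n n]) (use A E P Q in \<open>auto intro!: mats_add mats_minus mats_mult\<close>)
  also have "nrm ((A - P * A) + (P * A - P * A * Q)) \<le> nrm (A - P * A) + nrm (P * A - P * A * Q)"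
    by (rule nrm_triangle[OF _ n n]) (use A E P Q in \<open>auto intro!: mats_add mats_minus mats_mult\<close>)
  finally show ?thesis using left right err by (simp add: algebra_simps)
qed

text \<open>Expand \<open>(A T + E T) D (H\<^sup>* A + H\<^sup>* E)\<close> for \<open>D = U\<^sub>k\<^sup>\<dagger>\<close>. The main term satisfies
  \<open>A - A T D H\<^sup>* A = X (U - U D U) Y\<close> with \<open>U = H\<^sup>* A T\<close>, so that the factor \<open>t\<^sup>2\<close> meets a difference of small
  matrices only. Here \<open>D U\<close> and \<open>U D\<close> differ from orthogonal projections by \<open>D F\<close> and \<open>F D\<close>, where
  \<open>F = H\<^sup>* E T\<close> is the perturbation of \<open>U\<close>; the gap assumption makes these products at most
  \<open>\<delta> \<le> 1 / (2 \<mu>)\<close> because it keeps the \<open>k\<close>-th singular value of \<open>U + F\<close> above \<open>2 \<mu>\<close> times the norm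
  of \<open>E\<close>.\<close>

theorem cur_bound:
  assumes k: "1 \<le> k" and pos: "0 < sigma A (k - 1)"
    and \<mu>: "1 \<le> \<mu>" and gap: "4 * \<mu> * t\<^sup>2 * nrm E \<le> sigma A (k - 1)"
    and Uk: "is_truncated_svd K k (mat_adjoint H * (A + E) * T) Uk"
  shows "nrm (A - (A + E) * T * pinv Uk * (mat_adjoint H * (A + E)))
    \<le> (1 / (2 * \<mu>) + (2 + 1 / \<mu>) * t + (4 + 1 / (2 * \<mu>)) * t\<^sup>2) * nrm E"
proof -
  note [simp] = dims
  define U where "U = mat_adjoint H * A * T"
  define F where "F = mat_adjoint H * E * T"
  define D where "D = pinv Uk"
  define e where "e = nrm E"
  have e: "0 \<le> e" by (simp add: e_def nrm_E_nonneg)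
  have t: "0 \<le> t" using X by (simp add: op_bound_def)
  have Um: "U \<in> mats K p p" and Fm: "F \<in> mats K p p"
    unfolding U_def F_def using A E T H by (auto intro: mats_mult mats_adjoint)
  have UF: "mat_adjoint H * (A + E) * T = U + F" by (simp add: U_def F_def mat_distribs)
  note tU = truncated_svd[OF mats_add[OF Um Fm] Uk[unfolded UF], folded D_def]
  have [simp]: "dim_row U = p" "dim_col U = p" "dim_row F = p" "dim_col F = p" "dim_row D = p" "dim_col D = p"
    "dim_row Uk = p" "dim_col Uk = p"
    using matsD[OF Um] matsD[OF Fm] matsD[OF tU(1)] matsD[OF tU(2)] by auto
  note proj = pinv_projections[OF tU(3) matsD[OF tU(1)], folded D_def]

  have opE: "op_bound E e" unfolding e_def by (rule op_bound_nrm[OF E n n])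
  have opF: "op_bound F e"
    unfolding F_def using op_bound_mult[OF op_bound_mult[OF op_bound_H_adjoint opE] T(2)] by simp

  have XU: "X * U = A * T"
    using XA by (simp add: U_def mat_assoc[symmetric])
  have UY: "U * Y = mat_adjoint H * A"
    using AY by (simp add: U_def mat_assoc)
  have XUY: "X * U * Y = A" using XU AY by simp

  \<comment> \<open>From \<open>A = X U Y\<close>, passing to \<open>U\<close> costs a factor \<open>t\<^sup>2\<close>; the gap leaves room for \<open>F\<close>.\<close>
  have "sigma A (k - 1) \<le> t * t * sigma U (k - 1)"
    using sigma_mult_le[OF X(2) Y(2), of U "k - 1"] XUY by simp
  then have sU: "sigma A (k - 1) \<le> t\<^sup>2 * sigma U (k - 1)" by (simp add: power2_eq_square)
  then have t2: "0 < t\<^sup>2" using pos by (cases "t = 0") auto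
  have "t\<^sup>2 * (4 * \<mu> * e) \<le> t\<^sup>2 * sigma U (k - 1)" using gap sU by (simp add: e_def mult_ac)
  then have sU4: "4 * \<mu> * e \<le> sigma U (k - 1)" using t2 by simp
  have sU0: "0 < sigma U (k - 1)" using sU pos t2 by (meson less_le_trans zero_less_mult_pos)
  have "U = (U + F) + (0\<^sub>m p p - F)" by (rule eq_matI) auto
  then have pert: "sigma U (k - 1) \<le> sigma (U + F) (k - 1) + (0 + e)"
    using sigma_add_le[OF op_bound_minus[OF op_bound_zero opF], of p p "U + F" "k - 1"] by simp
  have \<mu>e: "e \<le> \<mu> * e" using \<mu> e by (simp add: mult_le_cancel_right1)
  define s where "s = sigma (U + F) (k - 1)"
  have s2: "2 * \<mu> * e \<le> s" using pert sU4 \<mu>e e by (simp add: s_def)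
  have s0: "0 < s"
  proof (cases "e = 0")
    case True then show ?thesis using pert sU0 by (simp add: s_def)
  next
    case False
    then have "0 < 2 * \<mu> * e" using \<mu> e by simp
    then show ?thesis using s2 by linarith
  qed
  have opD: "op_bound D (1 / s)" using tU(7)[OF k] s0 by (simp add: s_def)
  define \<delta> where "\<delta> = e / s"
  have \<delta>: "0 \<le> \<delta>" "\<delta> \<le> 1 / (2 * \<mu>)" using s0 s2 e \<mu> by (auto simp: \<delta>_def field_simps)

  \<comment> \<open>The products of \<open>D\<close> with \<open>U + F\<close> are projections since \<open>D\<close> does not see the truncated part.\<close>
  have DU: "D * U = D * Uk - D * F" and UD: "U * D = Uk * D - F * D"
  proof -
    have "D * U = D * (U + F) - D * F" "U * D = (U + F) * D - F * D"
      by (simp_all add: mat_distribs) (rule eq_matI; auto)+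
    then show "D * U = D * Uk - D * F" "U * D = Uk * D - F * D" using tU(4,5) by simp_all
  qed
  have opDU: "op_bound (D * U) (1 + \<delta>)"
    unfolding DU using op_bound_minus[OF proj(3) op_bound_mult[OF opD opF]] by (simp add: \<delta>_def)
  have opUD: "op_bound (U * D) (1 + \<delta>)"
    unfolding UD using op_bound_minus[OF proj(1) op_bound_mult[OF opF opD]] by (simp add: \<delta>_def)

  \<comment> \<open>Two units come from \<open>U - Uk\<close>, one from each projection, and \<open>\<delta>\<close> from the quadratic term.\<close>
  have core: "nrm (U - U * D * U) \<le> (4 + \<delta>) * e"
  proof -
    let ?a = "U - Uk" and ?b = "F * (D * Uk)" and ?c = "Uk * D * F" and ?d = "F * D * F"
    have "U * D * U = Uk - ?c - ?b + ?d"
    proof -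
      have "U * D * U = Uk * D * U - F * (D * U)"
        unfolding UD by (simp add: mat_distribs mat_assoc)
      also have "Uk * D * U = Uk * D * Uk - ?c"
        using DU by (simp add: mat_distribs mat_assoc)
      also have "Uk * D * Uk = Uk" using tU(3) by (simp add: is_pinv_def)
      also have "F * (D * U) = ?b - ?d" unfolding DU by (simp add: mat_distribs mat_assoc)
      finally show ?thesis by (simp only:) (rule eq_matI, auto)
    qed
    then have eq: "U - U * D * U = ?a + ?b + ?c - ?d"
      by (simp only:) (rule eq_matI, auto)
    have m: "?a \<in> mats K p p" "?b \<in> mats K p p" "?c \<in> mats K p p" "?d \<in> mats K p p"
      using Um Fm tU(1,2) by (auto intro!: mats_minus mats_mult)
    have nF: "nrm F \<le> e" using nrm_selected(3) by (simp add: F_def e_def)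
    have "nrm ?a \<le> 2 * nrm F"
      by (rule truncation_error[OF Um Fm p p]) (use rankA(3) Uk UF in \<open>auto simp: U_def\<close>)
    moreover have "nrm ?b \<le> 1 * 1 * nrm F"
      by (rule nrm_product_le[OF m(2) p p Fm p p _ op_bound_one _ proj(3)]) auto
    moreover have "nrm ?c \<le> 1 * 1 * nrm F"
      by (rule nrm_product_le[OF m(3) p p Fm p p _ proj(1) _ op_bound_one]) auto
    moreover have "nrm ?d \<le> (e * (1 / s)) * 1 * nrm F"
      by (rule nrm_product_le[OF m(4) p p Fm p p _ op_bound_mult[OF opF opD] _ op_bound_one]) auto
    moreover have "nrm (?a + ?b + ?c - ?d) \<le> nrm ?a + nrm ?b + nrm ?c + nrm ?d"
      using nrm_triangle_minus[OF mats_add[OF mats_add[OF m(1,2)] m(3)] m(4) p p]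
        nrm_triangle[OF mats_add[OF m(1,2)] p p m(3)] nrm_triangle[OF m(1) p p m(2)] by linarith
    ultimately have "nrm (U - U * D * U) \<le> (4 + \<delta>) * nrm F"
      unfolding eq by (simp add: \<delta>_def algebra_simps)
    also have "\<dots> \<le> (4 + \<delta>) * e" using nF \<delta> by (intro mult_left_mono) auto
    finally show ?thesis .
  qed

  let ?R = "mat_adjoint H * A" and ?HE = "mat_adjoint H * E"
  let ?t1 = "A - A * T * D * ?R" and ?t2 = "E * T * D * ?R" and ?t3 = "A * T * D * ?HE"
    and ?t4 = "E * T * D * ?HE"
  have m: "?t1 \<in> mats K n n" "?t2 \<in> mats K n n" "?t3 \<in> mats K n n" "?t4 \<in> mats K n n"
    using A E T(1) mats_adjoint[OF H(1)] tU(2) by (auto intro!: mats_minus mats_mult)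
  have "nrm ?t1 \<le> t * t * nrm (U - U * D * U)"
  proof (rule nrm_product_le[OF m(1) n n _ p p _ X(2) _ Y(2)])
    show "U - U * D * U \<in> mats K p p" using Um tU(2) by (auto intro!: mats_minus mats_mult)
    have "X * (U - U * D * U) * Y = X * U * Y - (X * U) * D * (U * Y)"
      by (simp add: mat_distribs mat_assoc)
    then show "?t1 = X * (U - U * D * U) * Y" unfolding XU UY AY by simp
  qed auto
  also have "\<dots> \<le> t * t * ((4 + \<delta>) * e)" using core t by (intro mult_left_mono) auto
  finally have n1: "nrm ?t1 \<le> (4 + \<delta>) * t\<^sup>2 * e" by (simp add: power2_eq_square mult_ac)
  have "nrm ?t2 \<le> 1 * (1 * ((1 + \<delta>) * t)) * nrm E"
  proof (rule nrm_product_le[OF m(2) n n E n n _ op_bound_one])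
    show "op_bound (T * (D * U * Y)) (1 * ((1 + \<delta>) * t))"
      by (intro op_bound_mult T opDU Y) auto
    show "?t2 = 1\<^sub>m n * E * (T * (D * U * Y))"
      unfolding UY[symmetric] by (simp add: mat_assoc)
  qed auto
  then have n2: "nrm ?t2 \<le> (1 + \<delta>) * t * e" by (simp add: e_def)
  have "nrm ?t3 \<le> (t * (1 + \<delta>) * 1) * 1 * nrm E"
  proof (rule nrm_product_le[OF m(3) n n E n n _ _ _ op_bound_one])
    show "op_bound (X * (U * D) * mat_adjoint H) (t * (1 + \<delta>) * 1)"
      by (intro op_bound_mult op_bound_H_adjoint opUD X) auto
    show "?t3 = X * (U * D) * mat_adjoint H * E * 1\<^sub>m n"
      unfolding XU[symmetric] by (simp add: mat_assoc)
  qed auto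
  then have n3: "nrm ?t3 \<le> (1 + \<delta>) * t * e" by (simp add: e_def mult_ac)
  have "nrm ?t4 \<le> 1 * (1 * (1 / s) * (1 * e)) * nrm E"
  proof (rule nrm_product_le[OF m(4) n n E n n _ op_bound_one])
    show "op_bound (T * D * ?HE) (1 * (1 / s) * (1 * e))"
      by (intro op_bound_mult op_bound_H_adjoint T opD opE) auto
    show "?t4 = 1\<^sub>m n * E * (T * D * ?HE)" by (simp add: mat_assoc)
  qed auto
  then have n4: "nrm ?t4 \<le> \<delta> * e" by (simp add: e_def \<delta>_def)

  have "A - (A + E) * T * D * (mat_adjoint H * (A + E)) = ?t1 - ?t2 - ?t3 - ?t4"
  proof -
    have "(A + E) * T * D * (mat_adjoint H * (A + E)) = (A * T * D * ?R + ?t3) + (?t2 + ?t4)"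
      by (simp add: mat_distribs) (rule eq_matI, auto)
    then show ?thesis by (simp only:) (rule eq_matI, auto)
  qed
  also have "nrm \<dots> \<le> nrm ?t1 + nrm ?t2 + nrm ?t3 + nrm ?t4"
    using nrm_triangle_minus[OF mats_minus[OF mats_minus[OF m(1,2)] m(3)] m(4) n n]
      nrm_triangle_minus[OF mats_minus[OF m(1,2)] m(3) n n] nrm_triangle_minus[OF m(1,2) n n] by linarith
  also have "\<dots> \<le> (\<delta> + 2 * (1 + \<delta>) * t + (4 + \<delta>) * t\<^sup>2) * e"
    using n1 n2 n3 n4 by (simp add: algebra_simps)
  also have "\<dots> \<le> (1 / (2 * \<mu>) + 2 * (1 + 1 / (2 * \<mu>)) * t + (4 + 1 / (2 * \<mu>)) * t\<^sup>2) * e"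
    using \<delta> t e by (intro mult_right_mono add_mono mult_left_mono) auto
  also have "2 * (1 + 1 / (2 * \<mu>)) = 2 + 1 / \<mu>" using \<mu> by (simp add: field_simps)
  finally show ?thesis by (simp add: D_def e_def)
qed

end

end

section \<open>Bounds for index sets of maximal volume\<close>

lemma mrank_rows_of_singular_gram:
  assumes V: "V \<in> carrier_mat n k" and S: "S \<subseteq> {..<n}" and k: "1 \<le> k" "k \<le> card S"
    and det: "det (gram V S) = 0"
  shows "mrank (submatrix V S UNIV) \<le> k - 1"
proof -
  let ?M = "submatrix V S UNIV"
  note M = submatrix_rows_dim[OF V S]
  have "volume ?M = 0" using det det_gram[OF V S k(2)] by simp
  then obtain i where i: "i \<in> {1..min (dim_row ?M) (dim_col ?M)}" "sing_val ?M i = 0"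
    unfolding volume_def by auto
  then have z: "sigma ?M (i - 1) = 0" using sigma_sing_val[of "i - 1" ?M] by (cases i) auto
  have "i - 1 \<le> k - 1" using i M by auto
  from sigma_antimono[OF this, of ?M] z have "sigma ?M (k - 1) = 0"
    using sigma_nonneg[of ?M "k - 1"] by linarith
  then show ?thesis by (simp add: mrank_le_iff_sigma)
qed

text \<open>The rank of \<open>A(I, J)\<close> forces the rows \<open>W\<^sub>I\<close> and \<open>V\<^sub>J\<close> of the singular vectors to have full rank,
  since \<open>A(I, J) = W\<^sub>I S V\<^sub>J\<^sup>*\<close> factors through both.\<close>

lemma gram_nonsingular_of_core_rank:
  assumes W: "W \<in> carrier_mat n k" and V: "V \<in> carrier_mat n k" and S: "S \<in> carrier_mat k k"
    and I: "I \<subseteq> {..<n}" and J: "J \<subseteq> {..<n}" and k: "1 \<le> k" "k \<le> card I" "k \<le> card J"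
    and rank: "mrank (submatrix W I UNIV * S * mat_adjoint (submatrix V J UNIV)) = k"
  shows "det (gram W I) \<noteq> 0" "det (gram V J) \<noteq> 0"
proof -
  let ?W = "submatrix W I UNIV" and ?V = "submatrix V J UNIV"
  note Wc = submatrix_rows_dim[OF W I] and Vc = submatrix_rows_dim[OF V J]
  show "det (gram W I) \<noteq> 0"
  proof
    assume "det (gram W I) = 0"
    then obtain L M where LM: "L \<in> carrier_mat (card I) (k - 1)" "M \<in> carrier_mat (k - 1) k" "?W = L * M"
      using mrank_factorization[OF Wc mrank_rows_of_singular_gram[OF W I k(1,2)]] by metis
    have "M * S * mat_adjoint ?V \<in> carrier_mat (k - 1) (card J)"
      using LM(2) Vc by (auto intro!: carrier_matI)
    note le = mrank_mult_le[OF LM(1) this]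
    have eq: "?W * S * mat_adjoint ?V = L * (M * S * mat_adjoint ?V)"
      unfolding LM(3) using LM(1,2) S Vc by (simp add: mat_assoc)
    show False using le k(1) unfolding eq[symmetric] rank by simp
  qed
  show "det (gram V J) \<noteq> 0"
  proof
    assume "det (gram V J) = 0"
    then obtain L M where LM: "L \<in> carrier_mat (card J) (k - 1)" "M \<in> carrier_mat (k - 1) k" "?V = L * M"
      using mrank_factorization[OF Vc mrank_rows_of_singular_gram[OF V J k(1,3)]] by metis
    have "?W * S * mat_adjoint M \<in> carrier_mat (card I) (k - 1)"
      using LM(2) Wc by (auto intro!: carrier_matI)
    note le = mrank_mult_le[OF this mat_adjoint_carrier[OF LM(1)]]
    have eq: "?W * S * mat_adjoint ?V = ?W * S * mat_adjoint M * mat_adjoint L"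
      unfolding LM(3) using LM(1,2) S Wc by (simp add: mat_assoc mat_adjoint_mult)
    show False using le k(1) unfolding eq[symmetric] rank by simp
  qed
qed

theorem corollary5p4:
  fixes K :: "complex set" and n k :: nat and I J :: "nat set"
    and A E At W S V C R U Ct Rt Ut :: "complex mat"
    and nrm :: "complex mat \<Rightarrow> real" and \<mu> t :: real
  assumes K: "K = \<real> \<or> K = UNIV"
    and A: "A \<in> mats K n n" and E: "E \<in> mats K n n" and At: "At = A + E"
    and k: "mrank A = k" "k \<ge> 1"
    and svd: "is_compact_svd K A W S V"
    and IJ: "I \<subseteq> {..<n}" "J \<subseteq> {..<n}" "card I = card J"
    and C: "C = submatrix A UNIV J" and R: "R = submatrix A I UNIV" and U: "U = submatrix A I J"
    and Ct: "Ct = submatrix At UNIV J" and Rt: "Rt = submatrix At I UNIV"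
    and Ut: "Ut = submatrix At I J"
    and ranks: "mrank C = k" "mrank U = k" "mrank R = k"
    and nrm: "norm_family K nrm" "normalized K nrm" "uniformly_generated K nrm"
      "unitarily_invariant K nrm" "submultiplicative K nrm"
    and mu: "pinv_perturbation_constant K nrm \<mu>"
    and maxvol: "max_volume_rows W I" "max_volume_rows V J"
    and t: "t = sqrt (1 + real k * (real n - real (card I)) / (real (card I) - real k + 1))"
  shows "(\<forall>Ck Rk. is_truncated_svd K k Ct Ck \<and> is_truncated_svd K k Rt Rk \<longrightarrow>
            nrm (A - Ck * pinv Ck * At * pinv Rk * Rk) \<le> (4 * t + 3) * nrm E) \<and>
         (sing_val A k \<ge> 4 * \<mu> * t\<^sup>2 * nrm E \<longrightarrow>
            (\<forall>Uk. is_truncated_svd K k Ut Uk \<longrightarrow>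
               nrm (A - Ct * pinv Uk * Rt) \<le>
                 (1 / (2 * \<mu>) + (2 + 1 / \<mu>) * t + (4 + 1 / (2 * \<mu>)) * t\<^sup>2) * nrm E))"
proof -
  interpret unitarily_generated_norm K nrm
    by unfold_locales (fact K nrm)+
  define p where "p = card J"
  have d: "dim_row A = n" "dim_col A = n" "dim_row At = n" "dim_col At = n"
    using matsD[OF A] matsD[OF E] At by auto
  have W: "W \<in> carrier_mat n k" "mat_adjoint W * W = 1\<^sub>m k"
    and V: "V \<in> carrier_mat n k" "mat_adjoint V * V = 1\<^sub>m k"
    and S: "S \<in> carrier_mat k k" and ASVD: "A = W * S * mat_adjoint V"
    using svd k(1) d matsD unfolding is_compact_svd_def by (auto simp: sv_mat_def)
  define T where "T = sel n J"
  define H where "H = sel n I"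
  have T: "T \<in> mats K n p" "op_bound T 1" and H: "H \<in> mats K n p" "op_bound H 1"
    using mats_sel[of n J] mats_sel[of n I] op_bound_sel IJ by (auto simp: T_def H_def p_def)
  have [simp]: "dim_row T = n" "dim_col T = p" "dim_row H = n" "dim_col H = p"
    using IJ by (auto simp: T_def H_def p_def)

  have cols: "submatrix B UNIV J = B * T" if "dim_col B = n" for B
    using submatrix_cols[of J B] that IJ by (simp add: T_def)
  have rows: "submatrix B I UNIV = mat_adjoint H * B" if "dim_row B = n" for B
    using submatrix_rows[of I B] that IJ by (simp add: H_def)
  have rowsJ: "submatrix B J UNIV = mat_adjoint T * B" if "dim_row B = n" for B
    using submatrix_rows[of J B] that IJ by (simp add: T_def)
  have core: "submatrix B I J = mat_adjoint H * B * T" if "dim_row B = n" "dim_col B = n" for B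
    using that cols[of B] rows[of "B * T"] by (subst submatrix_split) (simp add: mat_assoc)
  have CE: "C = A * T" "R = mat_adjoint H * A" "U = mat_adjoint H * A * T"
    "Ct = (A + E) * T" "Rt = mat_adjoint H * (A + E)" "Ut = mat_adjoint H * (A + E) * T"
    unfolding C R U Ct Rt Ut using cols rows core d by (simp_all add: At)

  \<comment> \<open>\<open>U\<close> has \<open>p\<close> rows and rank \<open>k\<close>, so there are at least \<open>k\<close> selected rows and columns.\<close>
  have "sigma U p = 0"
    using CE(3) by (simp add: sigma_def length_singular_values)
  then have kp: "k \<le> p" using mrank_le_iff_sigma[of U p] ranks(2) by simp
  then have kI: "k \<le> card I" and kJ: "k \<le> card J" using IJ(3) by (auto simp: p_def)
  have p: "1 \<le> p" using kp k(2) by simp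
  have "p \<le> n" using card_mono[OF _ IJ(2)] by (simp add: p_def)
  then have n: "1 \<le> n" "k \<le> n" using p kp by auto

  let ?W = "submatrix W I UNIV" and ?V = "submatrix V J UNIV"
  have WI: "?W = mat_adjoint H * W" and VJ: "?V = mat_adjoint T * V" using W V rows rowsJ by auto
  have "U = ?W * S * mat_adjoint ?V"
    unfolding CE(3) WI VJ ASVD using W V S by (simp add: mat_assoc mat_adjoint_mult)
  then have nonsing: "det (gram W I) \<noteq> 0" "det (gram V J) \<noteq> 0"
    using gram_nonsingular_of_core_rank[OF W(1) V(1) S IJ(1,2) k(2) kI kJ] ranks(2) by auto
  obtain Y where Y: "Y \<in> carrier_mat p n" "mat_adjoint ?V * Y = mat_adjoint V" "op_bound Y t"
    using max_volume_interpolation[OF V IJ(2) kJ maxvol(2) nonsing(2)] t IJ(3)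
    by (metis p_def)
  obtain Z where Z: "Z \<in> carrier_mat p n" "mat_adjoint ?W * Z = mat_adjoint W" "op_bound Z t"
    using max_volume_interpolation[OF W IJ(1) kI maxvol(1) nonsing(1)] t IJ(3)
    by (metis p_def)
  have X: "mat_adjoint Z \<in> carrier_mat n p" "op_bound (mat_adjoint Z) t"
    using Z op_bound_adjoint by auto
  have XW: "mat_adjoint Z * ?W = W"
  proof -
    have "mat_adjoint Z * ?W = mat_adjoint (mat_adjoint ?W * Z)"
      using Z(1) W(1) WI by (simp add: mat_adjoint_mult)
    then show ?thesis unfolding Z(2) by simp
  qed
  have AY: "A * T * Y = A"
  proof -
    have "A * T * Y = W * S * (mat_adjoint ?V * Y)"
      unfolding ASVD VJ using W(1) V(1) S Y(1) by (simp add: mat_assoc mat_adjoint_mult)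
    then show ?thesis unfolding Y(2) ASVD .
  qed
  have XA: "mat_adjoint Z * (mat_adjoint H * A) = A"
  proof -
    have "mat_adjoint Z * (mat_adjoint H * A) = mat_adjoint Z * ?W * S * mat_adjoint V"
      unfolding ASVD WI using W(1) V(1) S Z(1) by (simp add: mat_assoc)
    then show ?thesis unfolding XW ASVD .
  qed
  have rk: "mrank (A * T) \<le> k" "mrank (mat_adjoint H * A) \<le> k" "mrank (mat_adjoint H * A * T) \<le> k"
    using ranks CE(1-3) by auto
  note setting = A E n(1) p T H X Y(1,3) XA AY rk

  have sv: "sing_val A k = sigma A (k - 1)"
    using sigma_sing_val[of "k - 1" A] k(2) n d by simp
  have pos: "0 < sigma A (k - 1)"
  proof -
    have "sigma A (k - 1) \<noteq> 0" using mrank_le_iff_sigma[of A "k - 1"] k by auto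
    then show ?thesis using sigma_nonneg[of A "k - 1"] by linarith
  qed
  have \<mu>: "1 \<le> \<mu>" using mu by (simp add: pinv_perturbation_constant_def)
  show ?thesis
  proof (intro conjI allI impI)
    fix Ck Rk assume "is_truncated_svd K k Ct Ck \<and> is_truncated_svd K k Rt Rk"
    then have "nrm (A - Ck * pinv Ck * At * pinv Rk * Rk) \<le> (4 * t + 1) * nrm E"
      unfolding CE At using projection_bound[OF setting] by blast
    also have "\<dots> \<le> (4 * t + 3) * nrm E"
      using nrm_nonneg[OF E n(1) n(1)] by (intro mult_right_mono) auto
    finally show "nrm (A - Ck * pinv Ck * At * pinv Rk * Rk) \<le> (4 * t + 3) * nrm E" .
  next
    fix Uk assume "4 * \<mu> * t\<^sup>2 * nrm E \<le> sing_val A k" "is_truncated_svd K k Ut Uk"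
    then show "nrm (A - Ct * pinv Uk * Rt)
        \<le> (1 / (2 * \<mu>) + (2 + 1 / \<mu>) * t + (4 + 1 / (2 * \<mu>)) * t\<^sup>2) * nrm E"
      unfolding CE sv using cur_bound[OF setting k(2) pos \<mu>] by blast
  qed
qed

end
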